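(* Let $n\ge1$ be such that there are at least two permissible sequences of length $n$, put $k=\lfloor\frac{n+1}{2}\rfloor$, and let $L_1=(\beta_1,\dots,\beta_n)$ and $L_2=(\gamma_1,\dots,\gamma_n)$ be two distinct permissible sequences of length $n$ (see context). Define polynomials $a_i=a_{n+1-i}$ for $1\le i\le k$ in variables $c,t_1,\dots,t_k$ by: if $\beta_i=\gamma_i=1$, $a_i=2t_i+1$; if $\beta_i=\gamma_i=0$, $a_i=2t_i+2$; if $\beta_i=0,\gamma_i=1$, $a_i=c+2+2t_i$; if $\beta_i=1,\gamma_i=0$, $a_i=c+1+2t_i$. Let $P_i,Q_i\in\mathbb{Z}[c,t_1,\dots,t_k]$ be given by $P_{-1}=1,Q_{-1}=0,P_0=0,Q_0=1$, $P_i=a_iP_{i-1}+P_{i-2}$, $Q_i=a_iQ_{i-1}+Q_{i-2}$ ($1\le i\le n$), and set $$a_0=(-1)^{n}\frac{Q_{n-1}P_{n-1}}{2}+t_0Q_n,\qquad F=F(t_0,c,t_1,\dots,t_k)=a_0^2+2t_0P_n+(-1)^nP_{n-1}^2.$$ Call $(t_0,c,t_1,\dots,t_k)$ admissible if $c,t_1,\dots,t_k$ are non-negative integers, $t_0\in\frac12\mathbb{Z}$ with $t_0Q_n\in\mathbb{Z}$, and $t_0>(-1)^{n+1}\frac{Q_{n-1}P_{n-1}}{2Q_n}$. Then: (i) $F$ is a multi-variable Fermat–Pell polynomial which, at admissible arguments, takes values in both parity classes associated with $L_1$ and $L_2$; the parity class of $F$ at an admissible argument depends only on the parity of $c$. (ii)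 For every admissible tuple, $a_0$ is a positive integer and $\sqrt F=[\,a_0;\overline{a_1,\dots,a_n,2a_0}\,]$. (iii) With $C=a_0Q_n+P_n$ and $H=Q_n$ one has $C^2-FH^2=(-1)^{n-1}$ identically, and $(C,H)$ is the fundamental polynomial solution of this equation, i.e. at every admissible tuple it gives the fundamental solution in integers of $X^2-FY^2=(-1)^{n-1}$.
   Context: A zero-one sequence $(\varepsilon_1,\dots,\varepsilon_n)$ is permissible if it is symmetric ($\varepsilon_i=\varepsilon_{n+1-i}$) and $\begin{pmatrix}0&1\\1&0\end{pmatrix}\prod_{i=1}^n\begin{pmatrix}\varepsilon_i&1\\1&0\end{pmatrix}$ does not have right column $\equiv(1,1)^T\pmod 2$. If $D$ is a positive integer with $\sqrt D=[b_0;\overline{b_1,\dots,b_n,2b_0}]$ (period $n+1$), then $(b_1,\dots,b_n)\bmod 2$ is a permissible sequence, and $D$ is said to be associated with it; the parity class of a permissible sequence is the set of positive integers associated with it. A polynomial $F$ with integer coefficients is a multi-variable Fermat–Pell polynomial if there exist integer polynomials $C,H$ with $C^2-FH^2=1$ identically or $C^2-FH^2=-1$ identically. $[c_0;\overline{c_1,\dots,c_m}]$ denotes the periodic simple continued fraction with period $c_1,\dots,c_m$; the fundamental solution of $X^2-DY^2=\pm1$ is the positive solution with least $X+Y\sqrt D$.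
   Formalization: In (i) F can have coefficients 1/4, so "integer polynomial" means integer-valued, or literal after c→2c+r, or literal if a_0 is integral; in (iii) minimality excludes tuples where √F has a shorter period (a_1..a_m,2a_0), m<n, m≡n mod 2; periods need not be minimal. *)

theory Defs
  imports "HOL-Analysis.Analysis" "HOL-Library.Poly_Mapping" "HOL-Number_Theory.Cong"
begin

definition cf_matrix :: "int \<Rightarrow> int ^ 2 ^ 2"
  where "cf_matrix e = vector [vector [e, 1], vector [1, 0]]"

definition perm_matrix :: "nat list \<Rightarrow> int ^ 2 ^ 2"
  where "perm_matrix es =
    vector [vector [0, 1], vector [1, 0]] ** foldr (\<lambda>e A. cf_matrix (int e) ** A) es (mat 1)"

definition permissible :: "nat list \<Rightarrow> bool"
  where "permissible es \<longleftrightarrow>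
    set es \<subseteq> {0, 1} \<and> rev es = es \<and>
    \<not> ([perm_matrix es $ 1 $ 2 = 1] (mod 2) \<and> [perm_matrix es $ 2 $ 2 = 1] (mod 2))"

primrec finite_cf :: "(nat \<Rightarrow> int) \<Rightarrow> nat \<Rightarrow> real"
  where
    "finite_cf x 0 = of_int (x 0)"
  | "finite_cf x (Suc m) = of_int (x 0) + 1 / finite_cf (\<lambda>i. x (Suc i)) m"

definition has_simple_cf :: "real \<Rightarrow> (nat \<Rightarrow> int) \<Rightarrow> bool"
  where "has_simple_cf \<alpha> x \<longleftrightarrow> (\<forall>i\<ge>1. x i > 0) \<and> finite_cf x \<longlonglongrightarrow> \<alpha>"

text \<open>
  \<open>has_periodic_cf \<alpha> c0 cs\<close> says that \<open>\<alpha>\<close> is the value of the simple continued fraction with first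
  term \<open>c0\<close> followed by the block \<open>cs\<close> repeated for ever. The block need not be the shortest
  possible one.
\<close>

definition has_periodic_cf :: "real \<Rightarrow> int \<Rightarrow> int list \<Rightarrow> bool"
  where "has_periodic_cf \<alpha> c0 cs \<longleftrightarrow>
    cs \<noteq> [] \<and> has_simple_cf \<alpha> (\<lambda>i. if i = 0 then c0 else cs ! ((i - 1) mod length cs))"

definition associated :: "int \<Rightarrow> nat list \<Rightarrow> bool"
  where "associated D L \<longleftrightarrow>
    D > 0 \<and>
    (\<exists>b0 bs. has_periodic_cf (sqrt (of_int D)) b0 (bs @ [2 * b0]) \<and>
             map (\<lambda>b. b mod 2) bs = map int L)"

definition parity_class :: "nat list \<Rightarrow> int set"
  where "parity_class L = {D. associated D L}"

definition positive_pell_solution :: "int \<Rightarrow> int \<Rightarrow> int \<Rightarrow> int \<Rightarrow> bool"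
  where "positive_pell_solution D e X Y \<longleftrightarrow> X > 0 \<and> Y > 0 \<and> X\<^sup>2 - D * Y\<^sup>2 = e"

definition fundamental_solution :: "int \<Rightarrow> int \<Rightarrow> int \<Rightarrow> int \<Rightarrow> bool"
  where "fundamental_solution D e X Y \<longleftrightarrow>
    positive_pell_solution D e X Y \<and>
    (\<forall>X' Y'. positive_pell_solution D e X' Y' \<longrightarrow>
       of_int X + of_int Y * sqrt (of_int D) \<le> of_int X' + of_int Y' * sqrt (of_int D))"

datatype pvar = Vc | Vt nat

type_synonym qpoly = "(pvar \<Rightarrow>\<^sub>0 nat) \<Rightarrow>\<^sub>0 rat"

definition Const :: "rat \<Rightarrow> qpoly"
  where "Const q = Poly_Mapping.single 0 q"

definition Var :: "pvar \<Rightarrow> qpoly"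
  where "Var v = Poly_Mapping.single (Poly_Mapping.single v 1) 1"

definition peval :: "(rat \<Rightarrow> 'a) \<Rightarrow> (pvar \<Rightarrow> 'a) \<Rightarrow> qpoly \<Rightarrow> 'a::comm_semiring_1"
  where "peval h \<rho> p =
    (\<Sum>m\<in>Poly_Mapping.keys p. h (Poly_Mapping.lookup p m) *
       (\<Prod>v\<in>Poly_Mapping.keys m. \<rho> v ^ Poly_Mapping.lookup m v))"

definition integer_polys :: "qpoly set"
  where "integer_polys = {p. \<forall>m. Poly_Mapping.lookup p m \<in> \<int>}"

definition integer_valued_polys :: "qpoly set"
  where "integer_valued_polys = {p. \<forall>\<rho> :: pvar \<Rightarrow> int. peval id (\<lambda>v. of_int (\<rho> v)) p \<in> \<int>}"

text \<open>
  The set \<open>R\<close> fixes what counts as an integer polynomial: \<open>integer_polys\<close> for integer coefficients,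
  \<open>integer_valued_polys\<close> for rational coefficients with integer values at integer points. The latter
  is needed because \<open>F_poly\<close> below may have coefficients with denominator 4: for \<open>\<beta> = (0,0,0)\<close> and
  \<open>\<gamma> = (1,1,1)\<close> it contains the monomial \<open>c\<^sup>6 / 4\<close>. The denominators disappear once the parity of \<open>c\<close>
  is fixed, that is, after \<open>subst_c 0\<close> or \<open>subst_c 1\<close>. Requiring \<open>H \<noteq> 0\<close> excludes the solution
  \<open>C = 1, H = 0\<close>, which exists for every \<open>F\<close>.
\<close>

definition fermat_pell :: "qpoly set \<Rightarrow> qpoly \<Rightarrow> bool"
  where "fermat_pell R F \<longleftrightarrow>
    F \<in> R \<and> (\<exists>C\<in>R. \<exists>H\<in>R. H \<noteq> 0 \<and> (C\<^sup>2 - F * H\<^sup>2 = 1 \<or> C\<^sup>2 - F * H\<^sup>2 = -1))"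

definition subst_c :: "nat \<Rightarrow> qpoly \<Rightarrow> qpoly"
  where "subst_c r p =
    peval Const (\<lambda>v. case v of Vc \<Rightarrow> 2 * Var Vc + of_nat r | Vt i \<Rightarrow> Var (Vt i)) p"

text \<open>The index is shifted by one: \<open>contP a (Suc i)\<close> is $P_i$ and \<open>contP a 0\<close> is $P_{-1}$.\<close>

fun contP :: "(nat \<Rightarrow> 'a::comm_semiring_1) \<Rightarrow> nat \<Rightarrow> 'a"
  where
    "contP a 0 = 1"
  | "contP a (Suc 0) = 0"
  | "contP a (Suc (Suc i)) = a (Suc i) * contP a (Suc i) + contP a i"

fun contQ :: "(nat \<Rightarrow> 'a::comm_semiring_1) \<Rightarrow> nat \<Rightarrow> 'a"
  where
    "contQ a 0 = 0"
  | "contQ a (Suc 0) = 1"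
  | "contQ a (Suc (Suc i)) = a (Suc i) * contQ a (Suc i) + contQ a i"

definition a_poly :: "nat list \<Rightarrow> nat list \<Rightarrow> nat \<Rightarrow> qpoly"
  where "a_poly \<beta> \<gamma> i =
    (let j = min i (length \<beta> + 1 - i); b = \<beta> ! (j - 1); g = \<gamma> ! (j - 1)
     in if b = 1 \<and> g = 1 then 2 * Var (Vt j) + 1
        else if b = 0 \<and> g = 0 then 2 * Var (Vt j) + 2
        else if b = 0 \<and> g = 1 then Var Vc + 2 + 2 * Var (Vt j)
        else Var Vc + 1 + 2 * Var (Vt j))"

definition P_last :: "nat list \<Rightarrow> nat list \<Rightarrow> qpoly"   \<comment> \<open>$P_n$\<close>
  where "P_last \<beta> \<gamma> = contP (a_poly \<beta> \<gamma>) (length \<beta> + 1)"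

definition P_prev :: "nat list \<Rightarrow> nat list \<Rightarrow> qpoly"   \<comment> \<open>$P_{n-1}$\<close>
  where "P_prev \<beta> \<gamma> = contP (a_poly \<beta> \<gamma>) (length \<beta>)"

definition Q_last :: "nat list \<Rightarrow> nat list \<Rightarrow> qpoly"   \<comment> \<open>$Q_n$\<close>
  where "Q_last \<beta> \<gamma> = contQ (a_poly \<beta> \<gamma>) (length \<beta> + 1)"

definition Q_prev :: "nat list \<Rightarrow> nat list \<Rightarrow> qpoly"   \<comment> \<open>$Q_{n-1}$\<close>
  where "Q_prev \<beta> \<gamma> = contQ (a_poly \<beta> \<gamma>) (length \<beta>)"

definition a0_poly :: "nat list \<Rightarrow> nat list \<Rightarrow> qpoly"
  where "a0_poly \<beta> \<gamma> =
    (-1) ^ length \<beta> * Const (1 / 2) * Q_prev \<beta> \<gamma> * P_prev \<beta> \<gamma> + Var (Vt 0) * Q_last \<beta> \<gamma>"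

definition F_poly :: "nat list \<Rightarrow> nat list \<Rightarrow> qpoly"
  where "F_poly \<beta> \<gamma> =
    (a0_poly \<beta> \<gamma>)\<^sup>2 + 2 * Var (Vt 0) * P_last \<beta> \<gamma> + (-1) ^ length \<beta> * (P_prev \<beta> \<gamma>)\<^sup>2"

definition C_poly :: "nat list \<Rightarrow> nat list \<Rightarrow> qpoly"
  where "C_poly \<beta> \<gamma> = a0_poly \<beta> \<gamma> * Q_last \<beta> \<gamma> + P_last \<beta> \<gamma>"

definition H_poly :: "nat list \<Rightarrow> nat list \<Rightarrow> qpoly"
  where "H_poly \<beta> \<gamma> = Q_last \<beta> \<gamma>"

definition value_at :: "qpoly \<Rightarrow> rat \<Rightarrow> nat \<Rightarrow> (nat \<Rightarrow> nat) \<Rightarrow> rat"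
  where "value_at p t0 c t =
    peval id (\<lambda>v. case v of Vc \<Rightarrow> of_nat c | Vt i \<Rightarrow> if i = 0 then t0 else of_nat (t i)) p"

definition admissible :: "nat list \<Rightarrow> nat list \<Rightarrow> rat \<Rightarrow> nat \<Rightarrow> (nat \<Rightarrow> nat) \<Rightarrow> bool"
  where "admissible \<beta> \<gamma> t0 c t \<longleftrightarrow>
    2 * t0 \<in> \<int> \<and> t0 * value_at (Q_last \<beta> \<gamma>) t0 c t \<in> \<int> \<and>
    t0 > (-1) ^ (length \<beta> + 1) * (value_at (Q_prev \<beta> \<gamma>) t0 c t * value_at (P_prev \<beta> \<gamma>) t0 c t)
           / (2 * value_at (Q_last \<beta> \<gamma>) t0 c t)"

text \<open>
  A block \<open>bs @ [2 * b0]\<close> for \<open>sqrt D\<close> can be several copies of a shorter block of the same kind.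
  If the two block lengths have the same parity, the shorter block yields a smaller solution of the
  same Pell equation: \<open>sqrt 3 = [1; 1, 2, 1, 2, \<dots>]\<close>, where the block \<open>[1, 2, 1, 2]\<close> gives
  \<open>7\<^sup>2 - 3 * 4\<^sup>2 = 1\<close> and the block \<open>[1, 2]\<close> gives \<open>2\<^sup>2 - 3 * 1\<^sup>2 = 1\<close>.
\<close>

definition shorter_same_parity_period :: "int \<Rightarrow> int \<Rightarrow> int list \<Rightarrow> bool"
  where "shorter_same_parity_period D b0 bs \<longleftrightarrow>
    (\<exists>m < length bs. even m = even (length bs) \<and>
       has_periodic_cf (sqrt (of_int D)) b0 (take m bs @ [2 * b0]))"

end

(*
Mod 2 the partial quotients a_1, ..., a_n reduce to L1 for even c and to L2 for odd c; permissibility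
says exactly that Q_{n-1} P_{n-1} is then even, which makes a_0 integral. The block is a palindrome, so
P_n = Q_{n-1}, and with Q_n P_{n-1} - P_n^2 = (-1)^n the polynomial F is the value for which
a_0 + sqrt F is fixed by the Moebius map of the block (2 a_0, a_1, ..., a_n); this gives the continued
fraction and the Pell identity. Since an infinite simple continued fraction is determined by its value,
the block, and hence the parity class, can be read off from F.
Conversely, a positive solution (X, Y) of X^2 - D Y^2 = +-1 yields a unimodular matrix fixing
b_0 + sqrt D. Euclid's algorithm factors it into matrices ((c, 1), (1, 0)), so it comes from a period
of the continued fraction, and the size of Y compares that period with the given one.
*)
theory Submission
  imports Defs
begin

section \<open>Evaluation of polynomials and subrings\<close>

text \<open>Write s = (-1)^n, Q = Q_n, P = P_n = Q_{n-1}, R = P_{n-1}. The fixed-point condition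
  reads (F - a_0^2) Q = 2 a_0 P + R, so Q has to divide the right-hand side. As Q R - P^2 = s, the
  inverse of P modulo Q is -s P, and therefore 2 a_0 = s P R + 2 t_0 Q: this is the origin of the
  one half in a_0 and of the half-integral t_0. Substituting back and using 1 + s P^2 = s Q R gives
  F - a_0^2 = 2 t_0 P + s R^2. The obstacle is that P R / 2 need not have integer coefficients
  before the parity of c is fixed. The parity argument is needed in three settings: for polynomials
  after c -> 2 c + r, pointwise at integer arguments, and at admissible arguments, where t_0 need
  not be an integer. It is therefore carried out once, for the image under an arbitrary ring
  homomorphism and relative to a subring \<open>S\<close> that has to contain the images of c, t_1,
  ..., t_k, but not that of t_0.\<close>

locale unital_ring_hom =
  fixes \<phi> :: "'a::comm_ring_1 \<Rightarrow> 'b::comm_ring_1"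
  assumes add: "\<phi> (x + y) = \<phi> x + \<phi> y"
    and mult: "\<phi> (x * y) = \<phi> x * \<phi> y"
    and one: "\<phi> 1 = 1"
begin

lemma zero: "\<phi> 0 = 0"
  using add[of 0 0] by simp

lemma minus: "\<phi> (- x) = - \<phi> x"
  using add[of x "- x"] zero by (simp add: eq_neg_iff_add_eq_0 add.commute)

lemma diff: "\<phi> (x - y) = \<phi> x - \<phi> y"
  using add[of x "- y"] minus by simp

lemma power: "\<phi> (x ^ k) = \<phi> x ^ k"
  by (induction k) (simp_all add: one mult)

lemma of_nat: "\<phi> (of_nat k) = of_nat k"
  by (induction k) (simp_all add: zero one add)

lemma numeral: "\<phi> (numeral k) = numeral k"
  using of_nat[of "numeral k"] by simp

lemma of_int: "\<phi> (of_int k) = of_int k"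
  by (cases k rule: int_cases2) (simp_all add: of_nat minus)

lemmas hom_simps = zero one add mult minus diff power of_nat numeral of_int

lemma contP: "\<phi> (contP a m) = contP (\<lambda>i. \<phi> (a i)) m"
  by (induction a m rule: contP.induct) (simp_all add: hom_simps)

lemma contQ: "\<phi> (contQ a m) = contQ (\<lambda>i. \<phi> (a i)) m"
  by (induction a m rule: contQ.induct) (simp_all add: hom_simps)

end

lemma unital_ring_hom_id: "unital_ring_hom id"
  by unfold_locales auto

lemma unital_ring_hom_of_int: "unital_ring_hom of_int"
  by unfold_locales auto

lemma unital_ring_hom_Const: "unital_ring_hom Const"
  by unfold_locales (simp_all add: Const_def single_add mult_single)

definition eval_monom :: "('v \<Rightarrow> 'a) \<Rightarrow> ('v \<Rightarrow>\<^sub>0 nat) \<Rightarrow> 'a::comm_semiring_1"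
  where "eval_monom \<rho> m = (\<Prod>v\<in>Poly_Mapping.keys m. \<rho> v ^ Poly_Mapping.lookup m v)"

text \<open>A common index set lets two monomials be multiplied factor by factor; absent variables
  have exponent 0 and contribute 1.\<close>

lemma eval_monom_superset:
  assumes "finite K" "Poly_Mapping.keys m \<subseteq> K"
  shows "eval_monom \<rho> m = (\<Prod>v\<in>K. \<rho> v ^ Poly_Mapping.lookup m v)"
  unfolding eval_monom_def
  by (rule prod.mono_neutral_left) (use assms in \<open>auto simp: in_keys_iff\<close>)

lemma eval_monom_add: "eval_monom \<rho> (m + m') = eval_monom \<rho> m * eval_monom \<rho> m'"
proof -
  let ?K = "Poly_Mapping.keys m \<union> Poly_Mapping.keys m'"
  have "finite ?K" by simp
  then show ?thesis
    using eval_monom_superset[of ?K m \<rho>] eval_monom_superset[of ?K m' \<rho>]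
      eval_monom_superset[of ?K "m + m'" \<rho>] Poly_Mapping.keys_add[of m m']
    by (simp add: lookup_add power_add prod.distrib)
qed

lemma eval_monom_zero: "eval_monom \<rho> 0 = 1"
  by (simp add: eval_monom_def)

lemma eval_monom_single: "eval_monom \<rho> (Poly_Mapping.single v (Suc 0)) = \<rho> v"
  by (simp add: eval_monom_def)

text \<open>Updating a fresh key amounts to adding a single term, so a statement that is stable
  under sums needs checking on single terms only.\<close>

lemma poly_mapping_add_induct [case_names zero single add]:
  assumes "P 0" and "\<And>m c. P (Poly_Mapping.single m c)" and "\<And>p q. P p \<Longrightarrow> P q \<Longrightarrow> P (p + q)"
  shows "P p"
proof (induction p rule: update_induct)
  case const
  show ?case by (fact assms(1))
next
  case (update f a b)
  have "Poly_Mapping.update a b f = f + Poly_Mapping.single a b"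
    using update(1)
    by (intro poly_mapping_eqI)
      (auto simp: lookup_update lookup_add lookup_single in_keys_iff when_def)
  then show ?case using update assms by simp
qed

lemma peval_superset:
  assumes "h 0 = 0" "finite K" "Poly_Mapping.keys p \<subseteq> K"
  shows "peval h \<rho> p = (\<Sum>m\<in>K. h (Poly_Mapping.lookup p m) * eval_monom \<rho> m)"
  unfolding peval_def eval_monom_def[symmetric]
  by (rule sum.mono_neutral_left) (use assms in \<open>auto simp: in_keys_iff\<close>)

lemma peval_add:
  assumes "unital_ring_hom h"
  shows "peval h \<rho> (p + q) = peval h \<rho> p + peval h \<rho> q"
proof -
  interpret h: unital_ring_hom h by (fact assms)
  let ?K = "Poly_Mapping.keys p \<union> Poly_Mapping.keys q"
  have "finite ?K" by simp
  then show ?thesis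
    using peval_superset[of h, OF h.zero, of ?K p \<rho>] peval_superset[of h, OF h.zero, of ?K q \<rho>]
      peval_superset[of h, OF h.zero, of ?K "p + q" \<rho>] Poly_Mapping.keys_add[of p q]
    by (simp add: lookup_add h.add distrib_right sum.distrib)
qed

lemma peval_single:
  assumes "unital_ring_hom h"
  shows "peval h \<rho> (Poly_Mapping.single m c) = h c * eval_monom \<rho> m"
  using peval_superset[of h "{m}" "Poly_Mapping.single m c" \<rho>] unital_ring_hom.zero[OF assms]
  by simp

lemma unital_ring_hom_peval:
  assumes "unital_ring_hom h"
  shows "unital_ring_hom (peval h \<rho>)"
proof
  interpret h: unital_ring_hom h by (fact assms)
  note single = peval_single[OF assms] and add = peval_add[OF assms]
  have zero: "peval h \<rho> 0 = 0"
    by (simp add: peval_def)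
  show "peval h \<rho> 1 = 1"
    using single[of \<rho> 0 1] by (simp add: h.one eval_monom_zero)
  show "peval h \<rho> (x + y) = peval h \<rho> x + peval h \<rho> y" for x y
    by (fact add)
  \<comment> \<open>Both sides are additive in each factor, so two inductions, one per factor,
    reduce multiplicativity to a product of two terms.\<close>
  have single_mult: "peval h \<rho> (Poly_Mapping.single m c * y) = peval h \<rho> (Poly_Mapping.single m c) * peval h \<rho> y"
    for m c y
    by (induction y rule: poly_mapping_add_induct)
      (simp_all add: zero add single mult_single eval_monom_add h.mult algebra_simps)
  show "peval h \<rho> (x * y) = peval h \<rho> x * peval h \<rho> y" for x y
    by (induction x rule: poly_mapping_add_induct)
      (simp_all add: zero add single_mult distrib_right)
qed

lemma peval_Var: "unital_ring_hom h \<Longrightarrow> peval h \<rho> (Var v) = \<rho> v"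
  by (simp add: Var_def peval_single eval_monom_single unital_ring_hom.one)

section \<open>Subrings and parity relative to a subring\<close>

locale subring_of =
  fixes S :: "'a::comm_ring_1 set"
  assumes of_int_closed: "of_int k \<in> S"
    and add_closed: "x \<in> S \<Longrightarrow> y \<in> S \<Longrightarrow> x + y \<in> S"
    and mult_closed: "x \<in> S \<Longrightarrow> y \<in> S \<Longrightarrow> x * y \<in> S"
begin

lemma numeral_closed: "numeral k \<in> S"
  using of_int_closed[of "numeral k"] by simp

lemma one_closed: "1 \<in> S"
  using of_int_closed[of 1] by simp

lemma zero_closed: "0 \<in> S"
  using of_int_closed[of 0] by simp

lemma uminus_closed: "x \<in> S \<Longrightarrow> - x \<in> S"
  using mult_closed[OF of_int_closed[of "- 1"]] by simp

lemma of_nat_closed: "of_nat k \<in> S"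
  using of_int_closed[of "int k"] by simp

lemma power_closed: "x \<in> S \<Longrightarrow> x ^ k \<in> S"
  by (induction k) (simp_all add: one_closed mult_closed)

lemmas closed = numeral_closed one_closed zero_closed uminus_closed of_nat_closed power_closed
  of_int_closed add_closed mult_closed

lemma contP_closed: "(\<And>i. 1 \<le> i \<Longrightarrow> i < m \<Longrightarrow> a i \<in> S) \<Longrightarrow> contP a m \<in> S"
  by (induction a m rule: contP.induct) (simp_all add: closed)

lemma contQ_closed: "(\<And>i. 1 \<le> i \<Longrightarrow> i < m \<Longrightarrow> a i \<in> S) \<Longrightarrow> contQ a m \<in> S"
  by (induction a m rule: contQ.induct) (simp_all add: closed)

text \<open>The quotient has to lie in \<open>S\<close>: inside a field such as the rationals, an
  unrestricted quotient would make every element congruent to every integer.\<close>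

definition cong2 :: "'a \<Rightarrow> int \<Rightarrow> bool"
  where "cong2 x k \<longleftrightarrow> (\<exists>u\<in>S. x = of_int k + 2 * u)"

lemma cong2I: "u \<in> S \<Longrightarrow> x = of_int k + 2 * u \<Longrightarrow> cong2 x k"
  by (auto simp: cong2_def)

lemma cong2_of_int: "cong2 (of_int k) k"
  by (rule cong2I[of 0]) (simp_all add: closed)

lemma cong2_add:
  assumes "cong2 x k" "cong2 y l"
  shows "cong2 (x + y) (k + l)"
proof -
  obtain u v where "u \<in> S" "v \<in> S" "x = of_int k + 2 * u" "y = of_int l + 2 * v"
    using assms by (auto simp: cong2_def)
  then show ?thesis
    by (intro cong2I[of "u + v"]) (simp_all add: closed algebra_simps)
qed

lemma cong2_mult:
  assumes "cong2 x k" "cong2 y l"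
  shows "cong2 (x * y) (k * l)"
proof -
  obtain u v where "u \<in> S" "v \<in> S" "x = of_int k + 2 * u" "y = of_int l + 2 * v"
    using assms by (auto simp: cong2_def)
  then show ?thesis
    by (intro cong2I[of "of_int k * v + of_int l * u + 2 * (u * v)"])
      (simp_all add: closed algebra_simps)
qed

lemma cong2_contP: "(\<And>i. 1 \<le> i \<Longrightarrow> i < m \<Longrightarrow> cong2 (a i) (b i)) \<Longrightarrow> cong2 (contP a m) (contP b m)"
proof (induction a m rule: contP.induct)
  case (3 a i)
  then show ?case by (simp add: cong2_add cong2_mult)
qed (use cong2_of_int[of 0] cong2_of_int[of 1] in simp_all)

lemma cong2_contQ: "(\<And>i. 1 \<le> i \<Longrightarrow> i < m \<Longrightarrow> cong2 (a i) (b i)) \<Longrightarrow> cong2 (contQ a m) (contQ b m)"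
proof (induction a m rule: contQ.induct)
  case (3 a i)
  then show ?case by (simp add: cong2_add cong2_mult)
qed (use cong2_of_int[of 0] cong2_of_int[of 1] in simp_all)

lemma cong2_even: "cong2 x k \<Longrightarrow> even k \<Longrightarrow> \<exists>u\<in>S. x = 2 * u"
  by (auto simp: cong2_def elim!: evenE)
    (metis add_closed of_int_closed distrib_left)

end

lemma subring_of_Ints: "subring_of \<int>"
  by unfold_locales auto

lemma subring_of_UNIV: "subring_of UNIV"
  by unfold_locales auto

lemma subring_of_integer_polys: "subring_of integer_polys"
proof
  show add: "x + y \<in> integer_polys" if "x \<in> integer_polys" "y \<in> integer_polys" for x y
    using that by (simp add: integer_polys_def lookup_add)
  show "of_int k \<in> integer_polys" for k
    by (simp add: integer_polys_def lookup_of_int when_def)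
  have sum: "(\<Sum>i\<in>I. f i) \<in> integer_polys" if "\<And>i. i \<in> I \<Longrightarrow> f i \<in> integer_polys"
    for I :: "(pvar \<Rightarrow>\<^sub>0 nat) set" and f
    using that by (auto simp: integer_polys_def lookup_sum intro!: Ints_sum)
  have single: "Poly_Mapping.single m c \<in> integer_polys" if "c \<in> \<int>" for m c
    using that by (simp add: integer_polys_def lookup_single when_def)
  \<comment> \<open>Multiplying two such expansions leaves a sum of single terms whose coefficients
    are products of integers.\<close>
  have expand: "x = (\<Sum>m\<in>Poly_Mapping.keys x. Poly_Mapping.single m (Poly_Mapping.lookup x m))" for x :: qpoly
    by (intro poly_mapping_eqI)
      (simp add: lookup_sum lookup_single when_def in_keys_iff)
  show "x * y \<in> integer_polys" if "x \<in> integer_polys" "y \<in> integer_polys" for x y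
  proof -
    let ?x = "Poly_Mapping.lookup x" and ?y = "Poly_Mapping.lookup y"
    have "x * y = (\<Sum>m\<in>Poly_Mapping.keys x. \<Sum>m'\<in>Poly_Mapping.keys y. Poly_Mapping.single (m + m') (?x m * ?y m'))"
      by (subst expand[of x], subst expand[of y]) (simp only: sum_product mult_single)
    moreover have "?x m * ?y m' \<in> \<int>" for m m'
      using that by (simp add: integer_polys_def)
    ultimately show ?thesis by (simp only: sum single)
  qed
qed

lemma subring_of_integer_valued_polys: "subring_of integer_valued_polys"
proof
  fix x y :: qpoly and k :: int
  interpret unital_ring_hom "peval id \<rho>" for \<rho> :: "pvar \<Rightarrow> rat"
    by (rule unital_ring_hom_peval[OF unital_ring_hom_id])
  show "of_int k \<in> integer_valued_polys"
    by (simp add: integer_valued_polys_def of_int)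
  show "x + y \<in> integer_valued_polys" "x * y \<in> integer_valued_polys"
    if "x \<in> integer_valued_polys" "y \<in> integer_valued_polys"
    using that by (simp_all add: integer_valued_polys_def add mult)
qed

lemma Var_integer_poly: "Var v \<in> integer_polys"
  by (auto simp: integer_polys_def Var_def lookup_single when_def)

lemma contP_cong: "(\<And>i. 1 \<le> i \<Longrightarrow> i < m \<Longrightarrow> a i = b i) \<Longrightarrow> contP a m = contP b m"
  by (induction a m rule: contP.induct) simp_all

lemma contQ_cong: "(\<And>i. 1 \<le> i \<Longrightarrow> i < m \<Longrightarrow> a i = b i) \<Longrightarrow> contQ a m = contQ b m"
  by (induction a m rule: contQ.induct) simp_all

lemma contQ_pos:
  fixes a :: "nat \<Rightarrow> 'a::linordered_idom"
  shows "(\<And>i. 1 \<le> i \<Longrightarrow> i < Suc m \<Longrightarrow> a i > 0) \<Longrightarrow> contQ a (Suc m) > 0"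
proof (induction m rule: less_induct)
  case (less m)
  show ?case
  proof (cases m)
    case (Suc k)
    have "contQ a (Suc k) > 0" using less Suc by simp
    moreover have "contQ a k \<ge> 0"
    proof (cases k)
      case (Suc l)
      then show ?thesis using less.IH[of l] less.prems \<open>m = Suc k\<close> by simp
    qed simp
    ultimately show ?thesis using less.prems[of "Suc k"] Suc by (simp add: add_pos_nonneg)
  qed simp
qed

section \<open>Infinite simple continued fractions\<close>

lemma finite_cf_ge:
  "(\<And>i. 1 \<le> i \<Longrightarrow> x i > 0) \<Longrightarrow> finite_cf x m \<ge> of_int (x 0)"
proof (induction m arbitrary: x)
  case (Suc m)
  have "finite_cf (\<lambda>i. x (Suc i)) m \<ge> of_int (x 1)"
    using Suc.IH[of "\<lambda>i. x (Suc i)"] Suc.prems by simp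
  moreover have "real_of_int (x 1) > 0" using Suc.prems by simp
  ultimately have "finite_cf (\<lambda>i. x (Suc i)) m > 0" by linarith
  then show ?case by simp
qed simp

lemma finite_cf_le:
  assumes "\<And>i. 1 \<le> i \<Longrightarrow> x i > 0"
  shows "finite_cf x m \<le> of_int (x 0) + 1"
proof (cases m)
  case (Suc k)
  have "finite_cf (\<lambda>i. x (Suc i)) k \<ge> of_int (x 1)"
    using finite_cf_ge[of "\<lambda>i. x (Suc i)"] assms by simp
  moreover have "real_of_int (x 1) \<ge> 1" using assms[of 1] by simp
  ultimately have "finite_cf (\<lambda>i. x (Suc i)) k \<ge> 1" by linarith
  then show ?thesis using Suc by simp
qed simp

text \<open>
  Two steps of the recursion shrink the distance between two continued fractions with the same
  partial quotients by the factor \<open>(x f + 1) (x g + 1) \<ge> 4\<close>.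
\<close>

lemma cf_two_step_contraction:
  fixes x f g :: real
  assumes "x \<ge> 1" "f \<ge> 1" "g \<ge> 1"
  shows "\<bar>1 / (x + 1 / f) - 1 / (x + 1 / g)\<bar> \<le> \<bar>f - g\<bar> / 4"
proof -
  have ge: "x * f + 1 \<ge> 2" "x * g + 1 \<ge> 2"
    using mult_mono[of 1 x 1 f] mult_mono[of 1 x 1 g] assms by auto
  have "1 / (x + 1 / f) - 1 / (x + 1 / g) = (f - g) / ((x * f + 1) * (x * g + 1))"
    using assms ge by (simp add: divide_simps) (simp add: algebra_simps)
  then have "\<bar>1 / (x + 1 / f) - 1 / (x + 1 / g)\<bar> = \<bar>f - g\<bar> / ((x * f + 1) * (x * g + 1))"
    using ge by (simp add: abs_mult)
  moreover have "(x * f + 1) * (x * g + 1) \<ge> 4"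
    using mult_mono[OF ge] ge by simp
  ultimately show ?thesis
    using frac_le[of "\<bar>f - g\<bar>" "\<bar>f - g\<bar>" 4 "(x * f + 1) * (x * g + 1)"] by linarith
qed

text \<open>The \<open>\<alpha> i\<close> are the complete quotients. A gain of 4 per two steps is a
  factor 1/2 per step; the constant 2 makes the bound hold in the base cases \<open>m = 0\<close>
  and \<open>m = 1\<close>, where the error is at most 1.\<close>

lemma finite_cf_error:
  assumes "\<And>i. 1 \<le> i \<Longrightarrow> x i > 0" and "\<And>i. 1 \<le> i \<Longrightarrow> \<alpha> i \<ge> 1"
    and "\<And>i. \<alpha> i = of_int (x i) + 1 / \<alpha> (Suc i)"
  shows "\<bar>finite_cf x m - \<alpha> 0\<bar> \<le> 2 * (1 / 2) ^ m"
  using assms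
proof (induction m arbitrary: x \<alpha> rule: less_induct)
  case (less m)
  have x1: "x 1 \<ge> 1" and \<alpha>1: "\<alpha> 1 \<ge> 1" and \<alpha>2: "\<alpha> 2 \<ge> 1"
    using less.prems(1)[of 1] less.prems(2) by simp_all
  have x1': "real_of_int (x 1) \<ge> 1" using x1 by simp
  have \<alpha>0: "\<alpha> 0 = of_int (x 0) + 1 / \<alpha> 1" and \<alpha>1_eq: "\<alpha> 1 = of_int (x 1) + 1 / \<alpha> 2"
    using less.prems(3)[of 0] less.prems(3)[of 1] by (simp_all add: numeral_2_eq_2)
  consider "m = 0" | "m = 1" | k where "m = Suc (Suc k)"
    by (metis One_nat_def not0_implies_Suc)
  then show ?case
  proof cases
    case 1
    have "1 / \<alpha> 1 \<le> 1" "1 / \<alpha> 1 \<ge> 0" using \<alpha>1 by simp_all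
    then show ?thesis using 1 \<alpha>0 by simp
  next
    case 2
    have "1 / \<alpha> 1 \<le> 1" "1 / \<alpha> 1 \<ge> 0" "1 / real_of_int (x 1) \<le> 1" "1 / real_of_int (x 1) \<ge> 0"
      using \<alpha>1 x1' by simp_all
    then have "\<bar>1 / of_int (x 1) - 1 / \<alpha> 1\<bar> \<le> 1" by linarith
    then show ?thesis using 2 \<alpha>0 by simp
  next
    case (3 k)
    define f where "f = finite_cf (\<lambda>i. x (Suc (Suc i))) k"
    have "\<bar>finite_cf (\<lambda>i. x (Suc (Suc i))) k - (\<lambda>i. \<alpha> (Suc (Suc i))) 0\<bar> \<le> 2 * (1 / 2) ^ k"
    proof (rule less.IH)
      show "\<alpha> (Suc (Suc i)) = of_int (x (Suc (Suc i))) + 1 / \<alpha> (Suc (Suc (Suc i)))" for i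
        by (rule less.prems(3))
    qed (use less.prems(1,2) 3 in simp_all)
    then have "\<bar>f - \<alpha> 2\<bar> \<le> 2 * (1 / 2) ^ k"
      by (simp add: f_def numeral_2_eq_2)
    moreover have "f \<ge> 1"
    proof -
      have "f \<ge> of_int (x 2)"
        using finite_cf_ge[of "\<lambda>i. x (Suc (Suc i))" k] less.prems(1) by (simp add: f_def numeral_2_eq_2)
      moreover have "real_of_int (x 2) \<ge> 1" using less.prems(1)[of 2] by simp
      ultimately show ?thesis by linarith
    qed
    ultimately have "\<bar>1 / (x 1 + 1 / f) - 1 / (x 1 + 1 / \<alpha> 2)\<bar> \<le> 2 * (1 / 2) ^ k / 4"
      by (intro order_trans[OF cf_two_step_contraction[OF x1' _ \<alpha>2]] divide_right_mono) simp_all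
    then show ?thesis
      using 3 \<alpha>0 \<alpha>1_eq by (simp add: f_def)
  qed
qed

lemma has_simple_cfI:
  assumes "\<And>i. 1 \<le> i \<Longrightarrow> x i > 0" and "\<And>i. 1 \<le> i \<Longrightarrow> \<alpha> i \<ge> 1"
    and "\<And>i. \<alpha> i = of_int (x i) + 1 / \<alpha> (Suc i)"
  shows "has_simple_cf (\<alpha> 0) x"
proof -
  have "(\<lambda>m. 2 * (1 / 2) ^ m :: real) \<longlonglongrightarrow> 0"
    by (intro tendsto_mult_right_zero LIMSEQ_realpow_zero) simp_all
  then have "(\<lambda>m. finite_cf x m - \<alpha> 0) \<longlonglongrightarrow> 0"
    by (rule Lim_null_comparison[rotated]) (use finite_cf_error[of x \<alpha>, OF assms] in auto)
  then show ?thesis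
    using assms(1) by (simp add: has_simple_cf_def LIM_zero_iff)
qed

text \<open>The convergents of the tail stay between 1 and \<open>x 1 + 1\<close>, so their
  reciprocals stay away from 0. The limit \<open>\<alpha> - x 0\<close> is then positive and may be
  inverted.\<close>

lemma has_simple_cf_tail:
  assumes "has_simple_cf \<alpha> x"
  shows "of_int (x 0) < \<alpha>" "has_simple_cf (1 / (\<alpha> - of_int (x 0))) (\<lambda>i. x (Suc i))"
proof -
  have pos: "x i > 0" if "1 \<le> i" for i
    using assms that by (simp add: has_simple_cf_def)
  have lim: "finite_cf x \<longlonglongrightarrow> \<alpha>"
    using assms by (simp add: has_simple_cf_def)
  let ?f = "finite_cf (\<lambda>i. x (Suc i))"
  have x1: "real_of_int (x 1) \<ge> 1" using pos[of 1] by simp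
  have f_ge: "?f m \<ge> 1" and f_le: "?f m \<le> of_int (x 1) + 1" for m
    using finite_cf_ge[of "\<lambda>i. x (Suc i)" m] finite_cf_le[of "\<lambda>i. x (Suc i)" m] pos x1 by auto
  have lim': "(\<lambda>m. 1 / ?f m) \<longlonglongrightarrow> \<alpha> - of_int (x 0)"
    using tendsto_diff[OF LIMSEQ_Suc[OF lim] tendsto_const[of "of_int (x 0)"]] by simp
  have "1 / (of_int (x 1) + 1) \<le> \<alpha> - of_int (x 0)"
    by (rule LIMSEQ_le_const[OF lim']) (use f_ge f_le x1 in \<open>auto intro!: frac_le exI[of _ 0] order.strict_trans2[OF zero_less_one]\<close>)
  moreover have "1 / (real_of_int (x 1) + 1) > 0" using x1 by simp
  ultimately show less: "of_int (x 0) < \<alpha>" by linarith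
  have "(\<lambda>m. 1 / (1 / ?f m)) \<longlonglongrightarrow> 1 / (\<alpha> - of_int (x 0))"
    using less by (intro tendsto_divide[OF tendsto_const lim']) simp
  then show "has_simple_cf (1 / (\<alpha> - of_int (x 0))) (\<lambda>i. x (Suc i))"
    using pos by (simp add: has_simple_cf_def)
qed

text \<open>The next complete quotient is itself the value of an infinite expansion, so it strictly
  exceeds \<open>x 1 \<ge> 1\<close>. Hence \<open>x 0\<close> is the floor of
  \<open>\<alpha>\<close>, which drives the uniqueness proof.\<close>

lemma has_simple_cf_floor:
  assumes "has_simple_cf \<alpha> x"
  shows "of_int (x 0) < \<alpha>" "\<alpha> < of_int (x 0) + 1"
proof -
  show less: "of_int (x 0) < \<alpha>"
    by (rule has_simple_cf_tail(1)[OF assms])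
  have "real_of_int (x 1) < 1 / (\<alpha> - of_int (x 0))"
    using has_simple_cf_tail(1)[OF has_simple_cf_tail(2)[OF assms]] by simp
  moreover have "x 1 > 0"
    using assms by (simp add: has_simple_cf_def)
  ultimately have "1 < 1 / (\<alpha> - of_int (x 0))" by linarith
  with less show "\<alpha> < of_int (x 0) + 1"
    by (simp add: less_divide_eq)
qed

lemma has_simple_cf_unique:
  assumes "has_simple_cf \<alpha> x" "has_simple_cf \<alpha> y"
  shows "x i = y i"
  using assms
proof (induction i arbitrary: \<alpha> x y)
  case 0
  show ?case
    using has_simple_cf_floor[OF 0(1)] has_simple_cf_floor[OF 0(2)] by linarith
next
  case (Suc i)
  have "x 0 = y 0"
    using has_simple_cf_floor[OF Suc.prems(1)] has_simple_cf_floor[OF Suc.prems(2)] by linarith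
  then show ?case
    using Suc.IH[of _ "\<lambda>i. x (Suc i)" "\<lambda>i. y (Suc i)"] Suc.prems has_simple_cf_tail(2) by metis
qed

section \<open>Periodic expansions as fixed points of a block\<close>

definition cf_fold :: "int list \<Rightarrow> real \<Rightarrow> real"
  where "cf_fold cs w = foldr (\<lambda>c z. of_int c + 1 / z) cs w"

lemma cf_fold_simps [simp]:
  "cf_fold [] w = w"
  "cf_fold (c # cs) w = of_int c + 1 / cf_fold cs w"
  "cf_fold (cs @ ds) w = cf_fold cs (cf_fold ds w)"
  by (simp_all add: cf_fold_def)

lemma cf_fold_pos: "(\<And>c. c \<in> set cs \<Longrightarrow> c > 0) \<Longrightarrow> w > 0 \<Longrightarrow> cf_fold cs w > 0"
  by (induction cs) (simp_all add: add_pos_pos)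

text \<open>The complete quotients are the values obtained by folding the suffixes of the block onto
  \<open>w\<close>; the fixed-point equation closes the cycle.\<close>

lemma has_periodic_cfI:
  assumes cs: "cs \<noteq> []" "\<And>c. c \<in> set cs \<Longrightarrow> c > 0"
    and w: "w > 0" "cf_fold cs w = w" and s: "s = of_int c0 + 1 / w"
  shows "has_periodic_cf s c0 cs"
proof -
  let ?l = "length cs"
  define x where "x i = (if i = 0 then c0 else cs ! ((i - 1) mod ?l))" for i
  define \<alpha> where "\<alpha> i = (if i = 0 then s else cf_fold (drop ((i - 1) mod ?l) cs) w)" for i
  have l: "?l > 0" using cs by simp
  have step: "\<alpha> i = of_int (x i) + 1 / \<alpha> (Suc i)" for i
  proof (cases i)
    case 0
    then show ?thesis using w s by (simp add: \<alpha>_def x_def)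
  next
    case (Suc j)
    define r where "r = j mod ?l"
    have r: "r < ?l" using l by (simp add: r_def)
    \<comment> \<open>At the end of the block the left side folds the empty suffix and is
      \<open>w\<close>, while the right side folds all of \<open>cs\<close>; they agree because
      \<open>w\<close> is fixed.\<close>
    have "cf_fold (drop (Suc r) cs) w = cf_fold (drop (Suc j mod ?l) cs) w"
      using w by (simp add: mod_Suc r_def)
    then show ?thesis
      using Cons_nth_drop_Suc[OF r, symmetric] Suc by (simp add: \<alpha>_def x_def r_def)
  qed
  have pos: "x i > 0" if "i \<ge> 1" for i
    using that cs l by (simp add: x_def)
  have \<alpha>_pos: "\<alpha> i > 0" if "i \<ge> 1" for i
    using that cs w by (auto simp: \<alpha>_def intro!: cf_fold_pos dest: in_set_dropD)
  have "\<alpha> i \<ge> 1" if "i \<ge> 1" for i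
  proof -
    have "real_of_int (x i) \<ge> 1" using pos[OF that] by simp
    moreover have "1 / \<alpha> (Suc i) > 0" using \<alpha>_pos[of "Suc i"] by simp
    ultimately show ?thesis using step[of i] by linarith
  qed
  then have "has_simple_cf (\<alpha> 0) x"
    by (intro has_simple_cfI step pos)
  moreover have "\<alpha> 0 = s" by (simp add: \<alpha>_def)
  ultimately show ?thesis
    using cs by (simp add: has_periodic_cf_def x_def[abs_def])
qed

text \<open>Blocks need not be minimal and may differ in length, so the comparison is limited to
  positions inside both.\<close>

lemma has_periodic_cf_unique:
  assumes "has_periodic_cf s b0 bs" "has_periodic_cf s c0 cs"
  shows "b0 = c0" "i < length bs \<Longrightarrow> i < length cs \<Longrightarrow> bs ! i = cs ! i"
proof -
  have eq: "(if i = 0 then b0 else bs ! ((i - 1) mod length bs)) = (if i = 0 then c0 else cs ! ((i - 1) mod length cs))" for i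
    using has_simple_cf_unique assms unfolding has_periodic_cf_def by blast
  show "b0 = c0" using eq[of 0] by simp
  show "bs ! i = cs ! i" if "i < length bs" "i < length cs"
    using eq[of "Suc i"] that by simp
qed

section \<open>Continuant matrices\<close>

text \<open>The product of the matrices ((c, 1), (1, 0)), stored row by row, over any commutative
  ring so that polynomials and integers share it.\<close>

fun cf_mat :: "'a::comm_ring_1 list \<Rightarrow> 'a \<times> 'a \<times> 'a \<times> 'a"
  where
    "cf_mat [] = (1, 0, 0, 1)"
  | "cf_mat (c # cs) = (case cf_mat cs of (A, B, C, E) \<Rightarrow> (c * A + C, c * B + E, A, B))"

lemma cf_mat_snoc:
  "cf_mat cs = (A, B, C, E) \<Longrightarrow> cf_mat (cs @ [c]) = (A * c + B, A, C * c + E, C)"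
  by (induction cs arbitrary: A B C E) (auto split: prod.splits simp: algebra_simps)

text \<open>Every factor is symmetric, so reversing the product transposes it. A palindrome thus has
  equal off-diagonal entries.\<close>

lemma cf_mat_rev: "cf_mat cs = (A, B, C, E) \<Longrightarrow> cf_mat (rev cs) = (A, C, B, E)"
proof (induction cs arbitrary: A B C E)
  case (Cons c cs)
  obtain A' B' C' E' where "cf_mat cs = (A', B', C', E')" by (metis prod_cases4)
  then show ?case using Cons cf_mat_snoc[of "rev cs" A' C' B' E' c] by (auto simp: mult.commute)
qed simp

lemma cf_mat_det: "cf_mat cs = (A, B, C, E) \<Longrightarrow> A * E - B * C = (- 1) ^ length cs"
proof (induction cs arbitrary: A B C E)
  case (Cons c cs)
  obtain A' B' C' E' where "cf_mat cs = (A', B', C', E')" by (metis prod_cases4)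
  with Cons.IH[OF this] Cons.prems show ?case by (auto simp: algebra_simps)
qed simp

text \<open>One more factor on the right is one step of the continuant recursion. With the shifted
  index the entries are Q_n, Q_{n-1}, P_n, P_{n-1}.\<close>

lemma cf_mat_cont:
  "cf_mat (map a [1..<Suc n]) = (contQ a (Suc n), contQ a n, contP a (Suc n), contP a n)"
proof (induction n)
  case (Suc n)
  then show ?case using cf_mat_snoc[OF Suc.IH, of "a (Suc n)"] by (simp add: mult.commute)
qed simp

lemma cont_det:
  fixes a :: "nat \<Rightarrow> 'a::comm_ring_1"
  shows "contQ a (Suc n) * contP a n - contQ a n * contP a (Suc n) = (- 1) ^ n"
  using cf_mat_det[OF cf_mat_cont[of a n]] by (simp del: upt_Suc)

lemma rev_map_palindrome:
  assumes "\<And>i. 1 \<le> i \<Longrightarrow> i \<le> n \<Longrightarrow> a (n + 1 - i) = a i"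
  shows "rev (map a [1..<Suc n]) = map a [1..<Suc n]"
proof (rule nth_equalityI)
  fix i assume "i < length (rev (map a [1..<Suc n]))"
  then have "i < n" by (simp del: upt_Suc)
  moreover have "rev (map a [1..<Suc n]) ! i = a (n - i)"
    using \<open>i < n\<close> by (simp add: rev_nth Suc_diff_Suc del: upt_Suc)
  ultimately show "rev (map a [1..<Suc n]) ! i = map a [1..<Suc n] ! i"
    using assms[of "Suc i"] by (simp del: upt_Suc)
qed (simp del: upt_Suc)

lemma cont_palindrome:
  fixes a :: "nat \<Rightarrow> 'a::comm_ring_1"
  assumes "\<And>i. 1 \<le> i \<Longrightarrow> i \<le> n \<Longrightarrow> a (n + 1 - i) = a i"
  shows "contQ a n = contP a (Suc n)"
proof -
  have "rev (map a [1..<Suc n]) = map a [1..<Suc n]"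
    by (rule rev_map_palindrome) (rule assms)
  with cf_mat_rev[OF cf_mat_cont[of a n]]
  have "cf_mat (map a [1..<Suc n]) = (contQ a (Suc n), contP a (Suc n), contQ a n, contP a n)"
    by (simp only:)
  then show ?thesis
    unfolding cf_mat_cont by (elim Pair_inject)
qed

lemma cf_mat_nonneg:
  fixes cs :: "int list"
  assumes "cf_mat cs = (A, B, C, E)" "\<And>c. c \<in> set cs \<Longrightarrow> c > 0"
  shows "A > 0" "B \<ge> 0" "C \<ge> 0" "E \<ge> 0"
proof -
  have "case cf_mat cs of (A, B, C, E) \<Rightarrow> A > 0 \<and> B \<ge> 0 \<and> C \<ge> 0 \<and> E \<ge> 0"
    using assms(2)
  proof (induction cs)
    case (Cons c cs)
    obtain A' B' C' E' where M: "cf_mat cs = (A', B', C', E')" by (metis prod_cases4)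
    have "c > 0" using Cons.prems by simp
    moreover have "case cf_mat cs of (A, B, C, E) \<Rightarrow> A > 0 \<and> B \<ge> 0 \<and> C \<ge> 0 \<and> E \<ge> 0"
      by (rule Cons.IH) (use Cons.prems in simp)
    ultimately show ?case by (simp add: M add_pos_nonneg)
  qed simp
  then show "A > 0" "B \<ge> 0" "C \<ge> 0" "E \<ge> 0" using assms(1) by auto
qed

text \<open>The numerator belonging to \<open>cs\<close> is the denominator belonging to
  \<open>c # cs\<close>, so positivity and the formula are proved in one induction, in a form free
  of division.\<close>

lemma cf_fold_mat:
  assumes "cf_mat cs = (A, B, C, E)" "\<And>c. c \<in> set cs \<Longrightarrow> c > 0" "w > 0"
  shows "of_int C * w + of_int E > 0"
    and "cf_fold cs w = (of_int A * w + of_int B) / (of_int C * w + of_int E)"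
proof -
  have "case cf_mat cs of (A, B, C, E) \<Rightarrow>
    of_int C * w + of_int E > 0 \<and> cf_fold cs w * (of_int C * w + of_int E) = of_int A * w + of_int B"
    using assms(2)
  proof (induction cs)
    case (Cons c cs)
    obtain A' B' C' E' where M: "cf_mat cs = (A', B', C', E')" by (metis prod_cases4)
    let ?N = "of_int A' * w + of_int B'" and ?D = "of_int C' * w + of_int E'"
    have "case cf_mat cs of (A, B, C, E) \<Rightarrow>
      of_int C * w + of_int E > 0 \<and> cf_fold cs w * (of_int C * w + of_int E) = of_int A * w + of_int B"
      by (rule Cons.IH) (use Cons.prems in simp)
    then have IH: "?D > 0" "cf_fold cs w * ?D = ?N"
      by (simp_all only: M prod.case)
    have f: "cf_fold cs w > 0" by (rule cf_fold_pos) (use Cons.prems assms(3) in auto)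
    have "?N > 0" using mult_pos_pos[OF f IH(1)] IH(2) by simp
    moreover have "(of_int c + 1 / cf_fold cs w) * ?N = of_int c * ?N + ?D"
    proof -
      have "1 / cf_fold cs w * ?N = ?D" using f by (simp flip: IH(2))
      then show ?thesis by (simp only: distrib_right)
    qed
    ultimately show ?case
      by (simp only: M cf_mat.simps prod.case cf_fold_simps) (simp add: algebra_simps)
  qed simp
  then show "of_int C * w + of_int E > 0"
    "cf_fold cs w = (of_int A * w + of_int B) / (of_int C * w + of_int E)"
    using assms(1) by (auto simp: eq_divide_eq)
qed

text \<open>Appending \<open>d\<close> turns the leading entry \<open>A\<close> into
  \<open>A * d + B\<close>. The leading entry is the Y-coordinate of a Pell solution, so longer
  blocks give solutions at least as large.\<close>

lemma cf_mat_prefix_le: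
  fixes cs ds :: "int list"
  assumes "\<And>c. c \<in> set (cs @ ds) \<Longrightarrow> c > 0"
  shows "fst (cf_mat cs) \<le> fst (cf_mat (cs @ ds))"
  using assms
proof (induction ds rule: rev_induct)
  case (snoc d ds)
  obtain A B C E where M: "cf_mat (cs @ ds) = (A, B, C, E)" by (metis prod_cases4)
  have "A > 0" "B \<ge> 0" "d > 0" using cf_mat_nonneg[OF M] snoc.prems by auto
  moreover have "A * 1 \<le> A * d" by (rule mult_left_mono) (use calculation in auto)
  ultimately have "A \<le> A * d + B" by linarith
  then show ?case using snoc M cf_mat_snoc[OF M, of d] by simp
qed simp

text \<open>
  Euclid's algorithm on the first column. The inequalities pin down the second column, so that the
  determinant decides between the two continued fraction expansions of \<open>A / C\<close>.
\<close>

lemma cf_mat_decomposition: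
  fixes A B C E :: int
  assumes "1 \<le> C" "C \<le> A" "0 \<le> E" "E \<le> C" "1 \<le> B" "B \<le> A" "\<bar>A * E - B * C\<bar> = 1"
  shows "\<exists>cs. cs \<noteq> [] \<and> (\<forall>c\<in>set cs. c > 0) \<and> cf_mat cs = (A, B, C, E)"
  using assms
proof (induction "nat C" arbitrary: A B C E rule: less_induct)
  case less
  show ?case
  proof (cases "E = 0")
    case True
    then have "B * C = 1" using less.prems by (simp add: abs_mult)
    then have "B = 1" "C = 1" using less.prems by (auto simp: zmult_eq_1_iff)
    then show ?thesis using True less.prems by (intro exI[of _ "[A]"]) simp
  next
    case E: False
    show ?thesis
    proof (cases "C = 1")
      case True
      \<comment> \<open>A division by \<open>C = 1\<close> would leave remainder 0. With
        \<open>E = 1\<close> the determinant forces \<open>B = A - 1\<close>, and the expansion is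
        the one ending in 1, namely A = (A - 1) + 1/1.\<close>
      then have "E = 1" using E less.prems by simp
      then have "B = A - 1" using True less.prems by auto
      then show ?thesis using \<open>E = 1\<close> True less.prems by (intro exI[of _ "[A - 1, 1]"]) simp
    next
      case False
      then have C: "C \<ge> 2" using less.prems by simp
      define q where "q = A div C"
      \<comment> \<open>Removing the factor with quotient \<open>q\<close> leaves the matrix with
        rows (C, E) and (A', B'). What follows verifies the hypotheses for it; the lower-left entry
        drops from \<open>C\<close> to the remainder \<open>A'\<close>.\<close>
      define A' where "A' = A - q * C"
      define B' where "B' = B - q * E"
      have A'_mod: "A' = A mod C"
        by (simp add: A'_def q_def minus_div_mult_eq_mod)
      have q: "q \<ge> 1"
        using less.prems by (simp add: q_def pos_imp_zdiv_pos_iff int_one_le_iff_zero_less)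
      have det: "\<bar>A' * E - B' * C\<bar> = 1"
        using less.prems(7) by (simp add: A'_def B'_def algebra_simps)
      have A'_le: "A' \<ge> 0" "A' \<le> C - 1" using C by (simp_all add: A'_mod)
      have A'_pos: "A' \<ge> 1"
      proof (rule ccontr)
        assume "\<not> A' \<ge> 1"
        then have "A' = 0" using A'_le by simp
        then have "\<bar>B'\<bar> * \<bar>C\<bar> = 1" using det by (simp add: abs_mult)
        then show False using C by (simp add: zmult_eq_1_iff)
      qed
      have E_pos: "E \<ge> 1" using E less.prems by simp
      \<comment> \<open>The determinant keeps \<open>B' * C\<close> within 1 of
        \<open>A' * E\<close>; with \<open>C \<ge> 2\<close> and \<open>E \<ge> 1\<close> this gives
        \<open>0 \<le> B'\<close>, \<open>B' \<le> E\<close> and \<open>B' \<le> A'\<close>.\<close>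
      have B'C: "A' * E - 1 \<le> B' * C" "B' * C \<le> A' * E + 1" using det by auto
      have "A' * E \<ge> 1" using mult_mono[of 1 A' 1 E] A'_pos E_pos by simp
      then have "0 \<le> B' * C" using B'C by simp
      then have B'_ge: "0 \<le> B'" using C by (simp add: zero_le_mult_iff)
      have "B' * C < (E + 1) * C"
        using B'C(2) mult_right_mono[OF A'_le(2), of E] E_pos C by (simp add: algebra_simps)
      then have B'_le: "B' \<le> E" using C by (simp add: mult_less_cancel_right)
      have "B' * C < (A' + 1) * C"
      proof -
        have "A' * E \<le> A' * C" by (rule mult_left_mono) (use less.prems A'_pos in auto)
        then have "B' * C \<le> A' * C + 1" using B'C(2) by linarith
        then show ?thesis using C by (simp add: algebra_simps)
      qed
      then have B'_le': "B' \<le> A'" using C by (simp add: mult_less_cancel_right)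
      have "\<bar>C * B' - E * A'\<bar> = 1" using det by (simp add: mult.commute abs_minus_commute)
      then obtain cs where cs: "cs \<noteq> []" "\<forall>c\<in>set cs. c > 0" "cf_mat cs = (C, E, A', B')"
        using less.hyps[of A' C B' E] A'_le A'_pos B'_le B'_ge B'_le' less.prems E_pos C by auto
      then show ?thesis
        using q by (intro exI[of _ "q # cs"]) (simp add: A'_def B'_def)
    qed
  qed
qed

section \<open>Pell equations\<close>

text \<open>With s = sqrt F and \<open>\<alpha>\<close> = s + a0, expand (s - a0) (A
  \<open>\<alpha>\<close> + B) = B \<open>\<alpha>\<close> + E: the terms linear in s cancel because
  the off-diagonal entries agree, and the hypothesis on \<open>F\<close> remains. So the block sends
  s + a0 to 1 / (s - a0), and the quotient 2 a0 leads back.\<close>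

lemma has_periodic_cf_sqrt:
  fixes F a0 :: int
  assumes bs: "\<And>b. b \<in> set bs \<Longrightarrow> b > 0" "bs \<noteq> []" and M: "cf_mat bs = (A, B, B, E)"
    and a0: "a0 > 0" and F: "(F - a0\<^sup>2) * A = 2 * a0 * B + E"
  shows "F > a0\<^sup>2" "has_periodic_cf (sqrt (of_int F)) a0 (bs @ [2 * a0])"
proof -
  note nonneg = cf_mat_nonneg[OF M bs(1)]
  have det: "A * E - B * B = (- 1) ^ length bs" by (rule cf_mat_det[OF M])
  have "2 * a0 * B + E > 0"
  proof (cases "B = 0")
    case True
    then have "E \<noteq> 0" using det by auto
    then show ?thesis using nonneg a0 True by simp
  qed (use nonneg a0 in \<open>simp add: add_pos_nonneg\<close>)
  then have "(F - a0\<^sup>2) * A > 0" using F by simp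
  then show less: "F > a0\<^sup>2"
    using nonneg by (simp add: zero_less_mult_iff)
  define s where "s = sqrt (real_of_int F)"
  have "F > 0" using less by (rule le_less_trans[OF zero_le_power2])
  then have "s\<^sup>2 = of_int F" by (simp add: s_def)
  have "real_of_int (a0\<^sup>2) < of_int F" using less by (simp only: of_int_less_iff)
  then have "real_of_int a0 ^ 2 < of_int F" by simp
  then have s: "s > of_int a0" unfolding s_def by (rule real_less_rsqrt)
  define \<alpha> where "\<alpha> = s + of_int a0"
  define w where "w = 1 / (s - of_int a0)"
  have \<alpha>: "\<alpha> > 0" using s a0 by (simp add: \<alpha>_def)
  have w: "w > 0" using s by (simp add: w_def)
  have fold: "of_int B * \<alpha> + of_int E > 0"
    "cf_fold bs \<alpha> = (of_int A * \<alpha> + of_int B) / (of_int B * \<alpha> + of_int E)"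
    using cf_fold_mat[OF M _ \<alpha>] bs(1) by auto
  have "real_of_int ((F - a0\<^sup>2) * A) = of_int (2 * a0 * B + E)"
    using F by simp
  then have "(s\<^sup>2 - of_int a0 ^ 2) * of_int A = 2 * of_int a0 * of_int B + of_int E"
    unfolding \<open>s\<^sup>2 = of_int F\<close> by simp
  then have "(s - of_int a0) * (of_int A * \<alpha> + of_int B) = of_int B * \<alpha> + of_int E"
    by (simp add: \<alpha>_def algebra_simps power2_eq_square)
  then have "cf_fold bs \<alpha> = w"
    unfolding fold(2) w_def using fold(1) s by (subst frac_eq_eq) (simp_all add: mult.commute)
  moreover have "of_int (2 * a0) + 1 / w = \<alpha>"
    by (simp add: w_def \<alpha>_def)
  ultimately have "cf_fold (bs @ [2 * a0]) w = w" by simp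
  moreover have "s = of_int a0 + 1 / w" by (simp add: w_def)
  ultimately show "has_periodic_cf (sqrt (of_int F)) a0 (bs @ [2 * a0])"
    unfolding s_def[symmetric] using w bs a0 by (intro has_periodic_cfI) auto
qed

text \<open>
  A solution \<open>(X, Y)\<close> of \<open>X\<^sup>2 - D Y\<^sup>2 = \<plusminus>1\<close> gives the unimodular matrix
  \<open>((X + b0 Y, (D - b0\<^sup>2) Y), (Y, X - b0 Y))\<close>, which fixes \<open>b0 + sqrt D\<close>; its decomposition into
  elementary factors is a period of the continued fraction.
\<close>

lemma pell_solution_gives_period:
  fixes D :: int
  assumes b0: "b0 > 0" "b0\<^sup>2 < D" "D < (b0 + 1)\<^sup>2"
    and XY: "X > 0" "Y > 0" and e: "X\<^sup>2 - D * Y\<^sup>2 = e" "\<bar>e\<bar> = 1"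
  obtains ds where "\<And>d. d \<in> set ds \<Longrightarrow> d > 0" "fst (cf_mat ds) = Y" "e = (- 1) ^ Suc (length ds)"
    "has_periodic_cf (sqrt (of_int D)) b0 (ds @ [2 * b0])"
proof -
  \<comment> \<open>The gap of 1 between \<open>D\<close> and the neighbouring squares, multiplied
    by \<open>Y\<^sup>2 \<ge> 1\<close>, absorbs the right-hand side \<open>e\<close> and yields b0
    Y <= X <= (b0 + 1) Y, the bounds needed for the decomposition.\<close>
  have DY: "(b0\<^sup>2 + 1) * Y\<^sup>2 \<le> D * Y\<^sup>2" "D * Y\<^sup>2 \<le> ((b0 + 1)\<^sup>2 - 1) * Y\<^sup>2"
    using b0 by (intro mult_right_mono; simp)+
  have Y1: "Y\<^sup>2 \<ge> 1" using XY by (simp add: int_one_le_iff_zero_less)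
  have "(b0 * Y)\<^sup>2 \<le> X\<^sup>2"
    using DY(1) e Y1 unfolding power_mult_distrib by (simp add: distrib_right left_diff_distrib)
  then have X_ge: "b0 * Y \<le> X" by (rule power2_le_imp_le) (use XY in simp)
  have "X\<^sup>2 \<le> ((b0 + 1) * Y)\<^sup>2"
    using DY(2) e Y1 unfolding power_mult_distrib by (simp add: distrib_right left_diff_distrib)
  then have X_le: "X \<le> (b0 + 1) * Y" by (rule power2_le_imp_le) (use XY b0 in simp)
  let ?A = "X + b0 * Y" and ?B = "(D - b0\<^sup>2) * Y" and ?E = "X - b0 * Y"
  have "?A * ?E - ?B * Y = e"
    using e by (simp add: algebra_simps power2_eq_square)
  moreover have "Y \<le> b0 * Y" using mult_right_mono[of 1 b0 Y] b0 XY by simp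
  moreover have "1 * Y \<le> ?B" by (rule mult_right_mono) (use b0 XY in auto)
  moreover have "?B \<le> 2 * b0 * Y"
    by (rule mult_right_mono) (use b0 XY in \<open>auto simp: power2_eq_square algebra_simps\<close>)
  ultimately obtain cs where cs: "cs \<noteq> []" "\<forall>c\<in>set cs. c > 0" "cf_mat cs = (?A, ?B, Y, ?E)"
    using cf_mat_decomposition[of Y ?A ?E ?B] X_ge X_le XY e by (auto simp: algebra_simps)
  obtain c0 ds where cs_eq: "cs = c0 # ds" using cs by (cases cs) auto
  have ds: "d > 0" if "d \<in> set ds" for d using cs cs_eq that by simp
  \<comment> \<open>The lower row of the matrix of \<open>c0 # ds\<close> is the upper row of the
    matrix of \<open>ds\<close>.\<close>
  have Y: "fst (cf_mat ds) = Y"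
    using cs(3) cs_eq by (auto split: prod.splits)
  have len: "e = (- 1) ^ Suc (length ds)"
    using cf_mat_det[OF cs(3)] \<open>?A * ?E - ?B * Y = e\<close> cs_eq by simp
  define s where "s = sqrt (real_of_int D)"
  have "D > 0" using b0(2) by (rule le_less_trans[OF zero_le_power2])
  then have s2: "s\<^sup>2 = of_int D" and "s > 0" by (simp_all add: s_def)
  define \<alpha> where "\<alpha> = s + of_int b0"
  have \<alpha>: "\<alpha> > 0" using \<open>s > 0\<close> b0 by (simp add: \<alpha>_def)
  have fold: "of_int Y * \<alpha> + of_int ?E > 0" "cf_fold cs \<alpha> = (of_int ?A * \<alpha> + of_int ?B) / (of_int Y * \<alpha> + of_int ?E)"
    using cf_fold_mat[OF cs(3) _ \<alpha>] cs(2) by auto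
  have "of_int ?A * \<alpha> + of_int ?B = \<alpha> * (of_int Y * \<alpha> + of_int ?E)"
    using s2 by (simp add: \<alpha>_def algebra_simps power2_eq_square)
  then have "cf_fold cs \<alpha> = \<alpha>" using fold by (simp add: divide_eq_eq)
  define w where "w = cf_fold ds \<alpha>"
  have w: "w > 0" using ds \<alpha> by (simp add: w_def cf_fold_pos)
  have \<alpha>_w: "\<alpha> = of_int c0 + 1 / w"
    using \<open>cf_fold cs \<alpha> = \<alpha>\<close> by (simp add: cs_eq w_def)
  \<comment> \<open>The period of \<open>\<alpha>\<close> is rotated by one place: \<open>w\<close>
    has the block \<open>ds\<close> followed by \<open>c0\<close>, and \<open>s\<close>, being
    \<open>\<alpha>\<close> shifted by \<open>b0\<close>, starts with
    \<open>c0 - b0\<close>.\<close>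
  have "cf_fold (ds @ [c0]) w = cf_fold ds \<alpha>" using \<alpha>_w by simp
  then have "cf_fold (ds @ [c0]) w = w" by (simp only: w_def)
  moreover have "s = of_int (c0 - b0) + 1 / w" using \<alpha>_w by (simp add: \<alpha>_def)
  moreover have "\<And>c. c \<in> set (ds @ [c0]) \<Longrightarrow> c > 0" using cs(2) cs_eq by auto
  ultimately have per: "has_periodic_cf s (c0 - b0) (ds @ [c0])"
    using w by (intro has_periodic_cfI) simp_all
  then have "has_simple_cf s (\<lambda>i. if i = 0 then c0 - b0 else (ds @ [c0]) ! ((i - 1) mod length (ds @ [c0])))"
    by (simp add: has_periodic_cf_def)
  \<comment> \<open>Both \<open>c0 - b0\<close> and \<open>b0\<close> are the integer part of
    \<open>s\<close>, which forces \<open>c0 = 2 * b0\<close>.\<close>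
  from has_simple_cf_floor[OF this] have "of_int (c0 - b0) < s" "s < of_int (c0 - b0) + 1" by simp_all
  moreover have "of_int b0 < s" "s < of_int (b0 + 1)"
  proof -
    have "real_of_int (b0\<^sup>2) < of_int D" "of_int D < real_of_int ((b0 + 1)\<^sup>2)"
      using b0 by (simp_all only: of_int_less_iff)
    then have "real_of_int b0 ^ 2 < of_int D" "of_int D < real_of_int (b0 + 1) ^ 2"
      by simp_all
    then show "of_int b0 < s" "s < of_int (b0 + 1)"
      unfolding s_def using b0 by (auto intro: real_less_rsqrt real_less_lsqrt)
  qed
  ultimately have "c0 - b0 = b0" by linarith
  then have "c0 = 2 * b0" "c0 - b0 = b0" by simp_all
  with per have "has_periodic_cf (sqrt (of_int D)) b0 (ds @ [2 * b0])" by (simp add: s_def)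
  with ds Y len show ?thesis by (rule that)
qed

text \<open>A competing solution comes from a block \<open>ds\<close> that agrees with
  \<open>bs\<close> on their common range. The sign of the equation fixes the parity of its length,
  so \<open>minimal\<close> forbids it to be shorter; then \<open>bs\<close> is a prefix of
  \<open>ds\<close>, and leading entries cannot decrease from a prefix to the whole.\<close>

lemma fundamental_solution_if_no_shorter_period:
  assumes per: "has_periodic_cf (sqrt (of_int D)) b0 (bs @ [2 * b0])"
    and b0: "b0 > 0" and bs: "\<And>b. b \<in> set bs \<Longrightarrow> b > 0"
    and Y: "Y = fst (cf_mat bs)" and pell: "positive_pell_solution D ((- 1) ^ Suc (length bs)) X Y"
    and minimal: "\<not> shorter_same_parity_period D b0 bs"
  shows "fundamental_solution D ((- 1) ^ Suc (length bs)) X Y"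
  unfolding fundamental_solution_def
proof (intro conjI allI impI pell)
  fix X' Y' assume pell': "positive_pell_solution D ((- 1) ^ Suc (length bs)) X' Y'"
  let ?e = "(- 1) ^ Suc (length bs) :: int"
  have eqs: "X\<^sup>2 - D * Y\<^sup>2 = ?e" "X > 0" "Y > 0" "X'\<^sup>2 - D * Y'\<^sup>2 = ?e" "X' > 0" "Y' > 0"
    using pell pell' by (auto simp: positive_pell_solution_def)
  have "has_simple_cf (sqrt (of_int D))
    (\<lambda>i. if i = 0 then b0 else (bs @ [2 * b0]) ! ((i - 1) mod length (bs @ [2 * b0])))"
    using per by (simp add: has_periodic_cf_def)
  from has_simple_cf_floor[OF this] have s: "of_int b0 < sqrt (of_int D)" "sqrt (of_int D) < of_int b0 + 1"
    by simp_all
  have D: "D > 0"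
  proof -
    have "0 < real_of_int b0" using b0 by simp
    with s(1) have "sqrt (real_of_int D) > 0" by linarith
    then show ?thesis by simp
  qed
  have "b0\<^sup>2 < D" "D < (b0 + 1)\<^sup>2"
  proof -
    have s2: "sqrt (real_of_int D) ^ 2 = of_int D" using D by simp
    have "real_of_int b0 ^ 2 < sqrt (of_int D) ^ 2"
      by (rule power_strict_mono) (use s b0 in auto)
    then have "real_of_int (b0\<^sup>2) < of_int D" by (simp only: s2 of_int_power)
    then show "b0\<^sup>2 < D" by (simp only: of_int_less_iff)
    have "sqrt (of_int D) ^ 2 < (real_of_int b0 + 1) ^ 2"
      by (rule power_strict_mono) (use s D in auto)
    then have "real_of_int D < of_int ((b0 + 1)\<^sup>2)" by (simp only: s2 of_int_power of_int_add of_int_1)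
    then show "D < (b0 + 1)\<^sup>2" by (simp only: of_int_less_iff)
  qed
  with pell_solution_gives_period[of b0 D X' Y' ?e] b0 eqs
  obtain ds where ds: "\<And>d. d \<in> set ds \<Longrightarrow> d > 0" "fst (cf_mat ds) = Y'" "?e = (- 1) ^ Suc (length ds)"
    "has_periodic_cf (sqrt (of_int D)) b0 (ds @ [2 * b0])"
    by (auto simp: power_abs)
  have parity: "even (length ds) = even (length bs)"
    using ds(3) by (simp add: minus_one_power_iff split: if_splits)
  have nth: "ds ! i = bs ! i" if "i < length ds" "i < length bs" for i
    using has_periodic_cf_unique(2)[OF ds(4) per, of i] that by (simp add: nth_append)
  have "length ds \<ge> length bs"
  proof (rule ccontr)
    assume "\<not> length ds \<ge> length bs"
    then have less: "length ds < length bs" by simp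
    then have "take (length ds) bs = ds"
      by (intro nth_equalityI) (auto simp: nth)
    then have "shorter_same_parity_period D b0 bs"
      unfolding shorter_same_parity_period_def
      using less parity ds(4) by (intro exI[of _ "length ds"]) simp
    with minimal show False by contradiction
  qed
  then have "take (length bs) ds = bs"
    by (intro nth_equalityI) (auto simp: nth)
  then have "ds = bs @ drop (length bs) ds" by (metis append_take_drop_id)
  then have "Y \<le> Y'"
    using cf_mat_prefix_le[of bs "drop (length bs) ds"] ds Y by metis
  moreover have "X \<le> X'"
  proof (rule power2_le_imp_le)
    have "Y\<^sup>2 \<le> Y'\<^sup>2" using \<open>Y \<le> Y'\<close> eqs by simp
    then have "D * Y\<^sup>2 \<le> D * Y'\<^sup>2" using D by simp
    then show "X\<^sup>2 \<le> X'\<^sup>2" using eqs by linarith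
  qed (use eqs in simp)
  ultimately show "of_int X + of_int Y * sqrt (of_int D) \<le> of_int X' + of_int Y' * sqrt (of_int D)"
    using D by (intro add_mono mult_right_mono) auto
qed

section \<open>Pairs of permissible sequences\<close>

lemma unital_ring_hom_value_at: "unital_ring_hom (\<lambda>p. value_at p t0 c t)"
  unfolding value_at_def by (rule unital_ring_hom_peval[OF unital_ring_hom_id])

lemma unital_ring_hom_subst_c: "unital_ring_hom (subst_c r)"
  unfolding subst_c_def by (rule unital_ring_hom_peval[OF unital_ring_hom_Const])

lemma subst_c_Var:
  "subst_c r (Var Vc) = 2 * Var Vc + of_nat r" "subst_c r (Var (Vt j)) = Var (Vt j)"
  by (simp_all add: subst_c_def peval_Var unital_ring_hom_Const)

lemma value_at_Var:
  "value_at (Var Vc) t0 c t = of_nat c" "value_at (Var (Vt j)) t0 c t = (if j = 0 then t0 else of_nat (t j))"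
  by (simp_all add: value_at_def peval_Var unital_ring_hom_id)

text \<open>The target ring need not admit division by 2, so the image of one half is characterised
  by its double.\<close>

lemma unital_ring_hom_half:
  assumes "unital_ring_hom \<phi>"
  shows "2 * \<phi> (Const (1 / 2)) = 1"
proof -
  interpret \<phi>: unital_ring_hom \<phi> by fact
  interpret C: unital_ring_hom Const by (rule unital_ring_hom_Const)
  have "2 * Const (1 / 2) = Const (2 * (1 / 2))"
    by (simp only: C.mult C.numeral)
  also have "\<dots> = 1" by (simp add: C.one)
  finally have "\<phi> (2 * Const (1 / 2)) = 1" by (simp only: \<phi>.one)
  then show ?thesis by (simp only: \<phi>.mult \<phi>.numeral)
qed

lemma cong2_mod:
  assumes "subring_of S"
  shows "subring_of.cong2 S (of_int k) (int (nat (k mod 2)))"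
proof -
  interpret subring_of S by fact
  have "(of_int k :: 'a) = of_int (k mod 2 + 2 * (k div 2))" by simp
  also have "\<dots> = of_int (k mod 2) + 2 * of_int (k div 2)"
    by (simp only: of_int_add of_int_mult of_int_numeral)
  finally have "cong2 (of_int k) (k mod 2)" by (intro cong2I[OF of_int_closed])
  then show ?thesis by simp
qed

lemma nat_mod_two_less: "nat (k mod 2) < 2"
  by linarith

text \<open>\<open>a_poly\<close> with c and t_j replaced by elements of an arbitrary ring, so that
  the symbolic quotients, their images and their integer values are instances of one object.\<close>

definition a_form :: "'a::comm_ring_1 \<Rightarrow> (nat \<Rightarrow> 'a) \<Rightarrow> nat list \<Rightarrow> nat list \<Rightarrow> nat \<Rightarrow> 'a"
  where "a_form x y \<beta> \<gamma> i =
    (let j = min i (length \<beta> + 1 - i); b = \<beta> ! (j - 1); g = \<gamma> ! (j - 1)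
     in if b = 1 \<and> g = 1 then 2 * y j + 1
        else if b = 0 \<and> g = 0 then 2 * y j + 2
        else if b = 0 \<and> g = 1 then x + 2 + 2 * y j
        else x + 1 + 2 * y j)"

lemma a_poly_eq_a_form: "a_poly \<beta> \<gamma> = a_form (Var Vc) (\<lambda>j. Var (Vt j)) \<beta> \<gamma>"
  by (simp add: fun_eq_iff a_poly_def a_form_def)

lemma (in unital_ring_hom) a_form: "\<phi> (a_form x y \<beta> \<gamma> i) = a_form (\<phi> x) (\<lambda>j. \<phi> (y j)) \<beta> \<gamma> i"
  by (simp add: a_form_def Let_def hom_simps)

lemma a_form_sym:
  "1 \<le> i \<Longrightarrow> i \<le> length \<beta> \<Longrightarrow> a_form x y \<beta> \<gamma> (length \<beta> + 1 - i) = a_form x y \<beta> \<gamma> i"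
  by (simp add: a_form_def min.commute)

text \<open>Only indices from 1 on are read, so the value of \<open>y\<close> at 0, which is the
  possibly half-integral t_0 under \<open>value_at\<close>, never enters a partial quotient.\<close>

lemma a_form_cong:
  assumes "1 \<le> i" "i \<le> length \<beta>" "\<And>j. 1 \<le> j \<Longrightarrow> y j = y' j"
  shows "a_form x y \<beta> \<gamma> i = a_form x y' \<beta> \<gamma> i"
proof -
  have "1 \<le> min i (length \<beta> + 1 - i)" using assms by simp
  then show ?thesis using assms(3) by (simp add: a_form_def Let_def)
qed

lemma a_form_pos:
  fixes x :: "'a::linordered_idom"
  assumes "x \<ge> 0" "\<And>j. y j \<ge> 0"
  shows "a_form x y \<beta> \<gamma> i > 0"
proof -
  have "y (min i (length \<beta> + 1 - i)) \<ge> 0" by (rule assms)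
  with assms(1) show ?thesis by (simp add: a_form_def Let_def add_nonneg_pos)
qed

definition select :: "nat \<Rightarrow> nat list \<Rightarrow> nat list \<Rightarrow> nat list"
  where "select r \<beta> \<gamma> = (if even r then \<beta> else \<gamma>)"

lemma palindrome_nth:
  assumes "rev xs = xs" "1 \<le> i" "i \<le> length xs"
  shows "xs ! (min i (length xs + 1 - i) - 1) = xs ! (i - 1)"
proof (cases "i \<le> length xs + 1 - i")
  case False
  have "xs ! (i - 1) = rev xs ! (i - 1)" using assms by simp
  also have "\<dots> = xs ! (length xs + 1 - i - 1)"
    using assms by (subst rev_nth) simp_all
  finally show ?thesis using False by simp
qed simp

text \<open>The first factor of \<open>perm_matrix\<close> swaps the rows of the product, so its
  right column is (P_{n-1}, Q_{n-1}) of the zero-one sequence. The shift in \<open>l\<close> is due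
  to continuants reading their quotients from index 1.\<close>

lemma perm_matrix_cont:
  defines "l \<equiv> \<lambda>es i. int (es ! (i - 1))"
  shows "perm_matrix es $ 1 $ 2 = contP (l es) (length es)"
    and "perm_matrix es $ 2 $ 2 = contQ (l es) (length es)"
proof -
  define M where "M es = foldr (\<lambda>e A. cf_matrix (int e) ** A) es (mat 1)" for es
  have M: "cf_mat (map int es) = (M es $ 1 $ 1, M es $ 1 $ 2, M es $ 2 $ 1, M es $ 2 $ 2)" for es
    by (induction es)
      (simp_all add: M_def mat_def cf_matrix_def matrix_matrix_mult_def sum_2 vector_2)
  have "map (l es) [1..<Suc (length es)] = map int es"
    by (rule nth_equalityI) (simp_all add: l_def del: upt_Suc)
  then have "cf_mat (map int es) = (contQ (l es) (Suc (length es)), contQ (l es) (length es),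
      contP (l es) (Suc (length es)), contP (l es) (length es))"
    using cf_mat_cont[of "l es" "length es"] by (simp only:)
  with M[of es] have "M es $ 1 $ 2 = contQ (l es) (length es)" "M es $ 2 $ 2 = contP (l es) (length es)"
    by simp_all
  then show "perm_matrix es $ 1 $ 2 = contP (l es) (length es)"
    "perm_matrix es $ 2 $ 2 = contQ (l es) (length es)"
    unfolding perm_matrix_def M_def[symmetric]
    by (simp_all add: matrix_matrix_mult_def sum_2 vector_2)
qed

lemma permissible_even:
  assumes "permissible es"
  shows "even (contQ (\<lambda>i. int (es ! (i - 1))) (length es) * contP (\<lambda>i. int (es ! (i - 1))) (length es))"
proof -
  have mod2: "[k = 1] (mod 2) \<longleftrightarrow> odd k" for k :: int
    by (simp add: cong_def odd_iff_mod_2_eq_one)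
  show ?thesis
    using assms unfolding permissible_def perm_matrix_cont mod2 by auto
qed

text \<open>
  Here \<open>Q\<close>, \<open>P\<close>, \<open>R\<close> are \<open>Q\<^sub>n\<close>, \<open>P\<^sub>n = Q\<^sub>n\<^sub>-\<^sub>1\<close>, \<open>P\<^sub>n\<^sub>-\<^sub>1\<close>, and \<open>h\<close> is one half.
\<close>

lemma pell_identity:
  fixes P Q R s h t a0 :: "'a::comm_ring_1"
  assumes h: "2 * h = 1" and s: "s * s = 1" and det: "Q * R - P * P = s"
    and a0: "a0 = s * h * P * R + t * Q"
  shows "(a0 * Q + P)\<^sup>2 - (a0\<^sup>2 + 2 * t * P + s * R\<^sup>2) * Q\<^sup>2 = - s"
proof -
  \<comment> \<open>In the identity \<open>a0\<^sup>2\<close> cancels and \<open>a0\<close> survives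
    only as \<open>2 * a0\<close>, from which the half has disappeared.\<close>
  have "2 * a0 = (2 * h) * (s * P * R) + 2 * t * Q"
    unfolding a0 by (simp add: algebra_simps)
  then have a0': "2 * a0 = s * P * R + 2 * t * Q" by (simp add: h)
  have "(a0 * Q + P)\<^sup>2 - (a0\<^sup>2 + 2 * t * P + s * R\<^sup>2) * Q\<^sup>2 =
      (2 * a0) * Q * P + P * P - 2 * t * P * Q * Q - s * R * R * Q * Q"
    by (simp add: power2_eq_square algebra_simps)
  also have "\<dots> = P * P - s * R * Q * (Q * R - P * P)"
    unfolding a0' by (simp add: algebra_simps)
  also have "\<dots> = P * P - (s * s) * (R * Q)"
    unfolding det by (simp add: algebra_simps)
  also have "\<dots> = - (Q * R - P * P)" by (simp add: s algebra_simps)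
  finally show ?thesis by (simp only: det)
qed

section \<open>Integrality of a_0 and the Fermat-Pell property\<close>

locale permissible_pair =
  fixes L1 L2 :: "nat list" and n :: nat
  assumes n: "n \<ge> 1" and length1: "length L1 = n" and length2: "length L2 = n"
    and permissible1: "permissible L1" and permissible2: "permissible L2"
begin

lemma length_select: "length (select r L1 L2) = n"
  by (simp add: select_def length1 length2)

lemma permissible_select: "permissible (select r L1 L2)"
  by (simp add: select_def permissible1 permissible2)

context
  fixes x :: "'a::comm_ring_1" and y :: "nat \<Rightarrow> 'a"
begin

lemma contQ_prev: "contQ (a_form x y L1 L2) n = contP (a_form x y L1 L2) (Suc n)"
  by (rule cont_palindrome) (use a_form_sym[of _ L1] length1 in simp)

lemma det: "contQ (a_form x y L1 L2) (Suc n) * contP (a_form x y L1 L2) n - contP (a_form x y L1 L2) (Suc n) * contP (a_form x y L1 L2) (Suc n) = (- 1) ^ n"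
  using cont_det[of "a_form x y L1 L2" n] by (simp only: contQ_prev)

end

text \<open>Where the two sequences differ, the quotient is congruent to c or to c + 1, chosen so
  that even c reproduces the bit of \<open>L1\<close> and odd c that of \<open>L2\<close>. Bits are
  read from the first half only; symmetry of the sequences covers the rest.\<close>

lemma cong2_a_form:
  assumes "subring_of S" "subring_of.cong2 S x (int r)" "r < 2" "\<And>j. 1 \<le> j \<Longrightarrow> y j \<in> S" "1 \<le> i" "i \<le> n"
  shows "subring_of.cong2 S (a_form x y L1 L2 i) (int (select r L1 L2 ! (i - 1)))"
proof -
  interpret subring_of S by fact
  define j where "j = min i (n + 1 - i)"
  have j: "1 \<le> j" "j \<le> n" using assms(5,6) by (auto simp: j_def)
  have nth: "L1 ! (i - 1) = L1 ! (j - 1)" "L2 ! (i - 1) = L2 ! (j - 1)"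
    using palindrome_nth[of L1 i] palindrome_nth[of L2 i] permissible1 permissible2 length1 length2 assms(5,6)
    by (simp_all add: permissible_def j_def)
  have mem: "L1 ! (j - 1) \<in> set L1" "L2 ! (j - 1) \<in> set L2"
    using j length1 length2 by (auto intro!: nth_mem)
  have "set L1 \<subseteq> {0, 1}" "set L2 \<subseteq> {0, 1}"
    using permissible1 permissible2 by (simp_all add: permissible_def)
  with mem have bits: "L1 ! (j - 1) = 0 \<or> L1 ! (j - 1) = 1" "L2 ! (j - 1) = 0 \<or> L2 ! (j - 1) = 1"
    by auto
  have y: "y j \<in> S" using assms(4) j by simp
  obtain u where u: "u \<in> S" "x = of_nat r + 2 * u"
    using assms(2) by (auto simp: cong2_def)
  have r: "r = 0 \<or> r = 1" using assms(3) by auto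
  \<comment> \<open>Witnesses by bit pair: \<open>y j\<close> for (1,1), \<open>y j + 1\<close> for
    (0,0), \<open>?v\<close> for (0,1); for (1,0) it is \<open>u + y j\<close> if
    \<open>r = 0\<close> and \<open>?v\<close> if \<open>r = 1\<close>, where 1 + 1 carries.\<close>
  let ?v = "u + 1 + y j"
  have vS: "?v \<in> S" "u + y j \<in> S" "y j + 1 \<in> S" using u y by (simp_all add: closed)
  show ?thesis
    unfolding a_form_def length1 Let_def j_def[symmetric] select_def
    using bits r
    by (elim disjE)
      (auto simp: nth[unfolded One_nat_def] u(2) distrib_left intro: cong2I[OF y] cong2I[OF vS(1)] cong2I[OF vS(2)] cong2I[OF vS(3)])
qed

text \<open>Continuants are integer polynomials in the quotients, so their parity can be computed
  from the selected permissible sequence. The half \<open>u\<close> is found inside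
  \<open>S\<close>.\<close>

lemma cont_prev_product_even:
  assumes "subring_of S" "subring_of.cong2 S x (int r)" "r < 2" "\<And>j. 1 \<le> j \<Longrightarrow> y j \<in> S"
  shows "\<exists>u\<in>S. contP (a_form x y L1 L2) (Suc n) * contP (a_form x y L1 L2) n = 2 * u"
proof -
  interpret subring_of S by fact
  let ?a = "a_form x y L1 L2" and ?l = "\<lambda>i. int (select r L1 L2 ! (i - 1))"
  have "cong2 (contQ ?a n * contP ?a n) (contQ ?l n * contP ?l n)"
    by (intro cong2_mult cong2_contQ cong2_contP cong2_a_form assms) simp_all
  moreover have "even (contQ ?l n * contP ?l n)"
    using permissible_even[OF permissible_select[of r]] by (simp only: length_select)
  ultimately show ?thesis
    unfolding contQ_prev by (rule cong2_even)
qed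

lemma polys_eq:
  "P_last L1 L2 = contP (a_poly L1 L2) (Suc n)" "P_prev L1 L2 = contP (a_poly L1 L2) n"
  "Q_last L1 L2 = contQ (a_poly L1 L2) (Suc n)" "Q_prev L1 L2 = contP (a_poly L1 L2) (Suc n)"
  by (simp_all add: P_last_def P_prev_def Q_last_def Q_prev_def length1 a_poly_eq_a_form contQ_prev)

lemma pell_identity_polys: "(C_poly L1 L2)\<^sup>2 - F_poly L1 L2 * (H_poly L1 L2)\<^sup>2 = (- 1) ^ (n - 1)"
proof -
  have half: "2 * Const (1 / 2) = 1"
    using unital_ring_hom_half[OF unital_ring_hom_id] by simp
  have "(C_poly L1 L2)\<^sup>2 - F_poly L1 L2 * (H_poly L1 L2)\<^sup>2 = - ((- 1) ^ n)"
    unfolding C_poly_def F_poly_def H_poly_def length1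
  proof (rule pell_identity[OF half])
    show "(- 1) ^ n * (- 1) ^ n = (1 :: qpoly)" by (simp flip: power_mult_distrib)
    show "Q_last L1 L2 * P_prev L1 L2 - P_last L1 L2 * P_last L1 L2 = (- 1) ^ n"
      unfolding polys_eq a_poly_eq_a_form by (rule det)
    show "a0_poly L1 L2 = (- 1) ^ n * Const (1 / 2) * P_last L1 L2 * P_prev L1 L2 + Var (Vt 0) * Q_last L1 L2"
      by (simp only: a0_poly_def polys_eq length1)
  qed
  also have "\<dots> = (- 1) ^ (n - 1)"
    using n by (cases n) simp_all
  finally show ?thesis .
qed

lemma hom_polys:
  assumes "unital_ring_hom \<phi>"
  shows "\<phi> (P_last L1 L2) = contP (\<lambda>i. \<phi> (a_poly L1 L2 i)) (Suc n)"
    "\<phi> (P_prev L1 L2) = contP (\<lambda>i. \<phi> (a_poly L1 L2 i)) n"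
    "\<phi> (Q_last L1 L2) = contQ (\<lambda>i. \<phi> (a_poly L1 L2 i)) (Suc n)"
proof -
  interpret unital_ring_hom \<phi> by fact
  show "\<phi> (P_last L1 L2) = contP (\<lambda>i. \<phi> (a_poly L1 L2 i)) (Suc n)"
    "\<phi> (P_prev L1 L2) = contP (\<lambda>i. \<phi> (a_poly L1 L2 i)) n"
    "\<phi> (Q_last L1 L2) = contQ (\<lambda>i. \<phi> (a_poly L1 L2 i)) (Suc n)"
    unfolding polys_eq by (rule contP contQ)+
qed

lemma hom_a_poly:
  "unital_ring_hom \<phi> \<Longrightarrow> \<phi> (a_poly L1 L2 i) = a_form (\<phi> (Var Vc)) (\<lambda>j. \<phi> (Var (Vt j))) L1 L2 i"
  unfolding a_poly_eq_a_form by (rule unital_ring_hom.a_form)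

text \<open>The formal one half in a_0 is traded for the witness \<open>u\<close> in
  \<open>S\<close>. The summand t_0 Q_n is kept apart, because each application has its own reason
  for its integrality.\<close>

lemma hom_a0_poly:
  assumes "unital_ring_hom \<phi>" "subring_of S" "subring_of.cong2 S (\<phi> (Var Vc)) (int r)" "r < 2"
    and "\<And>j. 1 \<le> j \<Longrightarrow> \<phi> (Var (Vt j)) \<in> S"
  shows "\<exists>u\<in>S. \<phi> (P_last L1 L2) * \<phi> (P_prev L1 L2) = 2 * u \<and>
    \<phi> (a0_poly L1 L2) = (- 1) ^ n * u + \<phi> (Var (Vt 0)) * \<phi> (Q_last L1 L2)"
proof -
  interpret unital_ring_hom \<phi> by fact
  obtain u where u: "u \<in> S" "\<phi> (P_last L1 L2) * \<phi> (P_prev L1 L2) = 2 * u"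
    using cont_prev_product_even[OF assms(2-4), of "\<lambda>j. \<phi> (Var (Vt j))", OF assms(5)]
    unfolding hom_polys[OF assms(1)] hom_a_poly[OF assms(1)] by blast
  have "\<phi> (a0_poly L1 L2) = (- 1) ^ n * (\<phi> (Const (1 / 2)) * (\<phi> (P_last L1 L2) * \<phi> (P_prev L1 L2)))
      + \<phi> (Var (Vt 0)) * \<phi> (Q_last L1 L2)"
    unfolding a0_poly_def length1 by (simp add: hom_simps polys_eq mult.assoc)
  also have "\<phi> (Const (1 / 2)) * (\<phi> (P_last L1 L2) * \<phi> (P_prev L1 L2)) = (2 * \<phi> (Const (1 / 2))) * u"
    unfolding u(2) by (simp only: mult_ac)
  finally show ?thesis
    using u by (auto simp: unital_ring_hom_half[OF assms(1)])
qed

lemma hom_a_poly_closed: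
  assumes "unital_ring_hom \<phi>" "subring_of S" "\<phi> (Var Vc) \<in> S" "1 \<le> i" "i \<le> n"
    and "\<And>j. 1 \<le> j \<Longrightarrow> \<phi> (Var (Vt j)) \<in> S"
  shows "\<phi> (a_poly L1 L2 i) \<in> S"
proof -
  interpret subring_of S by fact
  have "1 \<le> min i (length L1 + 1 - i)" using assms(4,5) length1 by simp
  then show ?thesis
    unfolding hom_a_poly[OF assms(1)] a_form_def Let_def using assms(3,6) by (simp add: closed)
qed

text \<open>The second homomorphism \<open>\<psi>\<close> only certifies that H is nonzero: at
  non-negative values of the variables all partial quotients are positive, hence so is Q_n.\<close>

lemma fermat_pell_hom:
  assumes "unital_ring_hom \<phi>" "subring_of S" "\<And>v. \<phi> (Var v) \<in> S" "\<phi> (a0_poly L1 L2) \<in> S"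
    and \<psi>: "unital_ring_hom (\<psi> :: qpoly \<Rightarrow> rat)" "\<And>v. \<psi> (\<phi> (Var v)) \<ge> 0"
  shows "fermat_pell S (\<phi> (F_poly L1 L2))"
proof -
  interpret unital_ring_hom \<phi> by fact
  interpret \<psi>: unital_ring_hom \<psi> by fact
  interpret S: subring_of S by fact
  have a: "\<phi> (a_poly L1 L2 i) \<in> S" if "1 \<le> i" "i < Suc n" for i
    by (rule hom_a_poly_closed[OF assms(1,2)]) (use that assms(3) in simp_all)
  have PQ: "\<phi> (P_last L1 L2) \<in> S" "\<phi> (P_prev L1 L2) \<in> S" "\<phi> (Q_last L1 L2) \<in> S"
    unfolding hom_polys[OF assms(1)] by (intro S.contP_closed S.contQ_closed a; simp)+
  have F: "\<phi> (F_poly L1 L2) \<in> S"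
    unfolding F_poly_def using PQ assms(3,4) by (simp add: hom_simps S.closed)
  have C: "\<phi> (C_poly L1 L2) \<in> S"
    unfolding C_poly_def using PQ assms(3,4) by (simp add: hom_simps S.closed)
  have "unital_ring_hom (\<lambda>p. \<psi> (\<phi> p))"
    by unfold_locales (simp_all add: hom_simps \<psi>.hom_simps)
  note comp = hom_polys[OF this] hom_a_poly[OF this]
  have "\<psi> (\<phi> (Q_last L1 L2)) > 0"
    unfolding comp using \<psi>(2) by (intro contQ_pos a_form_pos) simp_all
  then have H: "\<phi> (Q_last L1 L2) \<noteq> 0" using \<psi>.zero by auto
  have "(\<phi> (C_poly L1 L2))\<^sup>2 - \<phi> (F_poly L1 L2) * (\<phi> (Q_last L1 L2))\<^sup>2 = (- 1) ^ (n - 1)"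
    using arg_cong[OF pell_identity_polys, of \<phi>] by (simp add: hom_simps H_poly_def)
  moreover have "(- 1) ^ (n - 1) = (1 :: qpoly) \<or> (- 1) ^ (n - 1) = (- 1 :: qpoly)"
    by (simp add: minus_one_power_iff)
  ultimately show ?thesis
    unfolding fermat_pell_def using F C PQ(3) H by metis
qed

lemma fermat_pell_F_poly:
  "fermat_pell integer_valued_polys (F_poly L1 L2)"
  "a0_poly L1 L2 \<in> integer_polys \<Longrightarrow> fermat_pell integer_polys (F_poly L1 L2)"
proof -
  let ?\<psi> = "peval id (\<lambda>_. 0) :: qpoly \<Rightarrow> rat"
  have \<psi>: "unital_ring_hom ?\<psi>" by (rule unital_ring_hom_peval[OF unital_ring_hom_id])
  have id: "unital_ring_hom (\<lambda>p :: qpoly. p)" by unfold_locales auto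
  note main = fermat_pell_hom[OF id _ _ _ \<psi>]
  have pos: "?\<psi> (Var v) \<ge> 0" for v by (simp add: peval_Var unital_ring_hom_id)
  show "fermat_pell integer_polys (F_poly L1 L2)" if "a0_poly L1 L2 \<in> integer_polys"
    using main[OF subring_of_integer_polys Var_integer_poly that pos] .
  have Var: "Var v \<in> integer_valued_polys" for v
    by (simp add: integer_valued_polys_def peval_Var unital_ring_hom_id)
  \<comment> \<open>As a variable, c has no parity; at a given integer point it does, so integrality
    is decided point by point.\<close>
  have a0: "a0_poly L1 L2 \<in> integer_valued_polys"
    unfolding integer_valued_polys_def mem_Collect_eq
  proof
    fix \<rho> :: "pvar \<Rightarrow> int"
    let ?\<phi> = "peval id (\<lambda>v. of_int (\<rho> v)) :: qpoly \<Rightarrow> rat"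
    have \<phi>: "unital_ring_hom ?\<phi>" by (rule unital_ring_hom_peval[OF unital_ring_hom_id])
    have Var_eq: "?\<phi> (Var v) = of_int (\<rho> v)" for v by (simp add: peval_Var unital_ring_hom_id)
    interpret subring_of "\<int> :: rat set" by (rule subring_of_Ints)
    have a: "?\<phi> (a_poly L1 L2 i) \<in> \<int>" if "1 \<le> i" "i < Suc n" for i
      by (rule hom_a_poly_closed[OF \<phi> subring_of_Ints]) (use that in \<open>simp_all add: Var_eq\<close>)
    have "?\<phi> (Q_last L1 L2) \<in> \<int>"
      unfolding hom_polys[OF \<phi>] by (intro contQ_closed a) simp_all
    moreover have "cong2 (?\<phi> (Var Vc)) (int (nat (\<rho> Vc mod 2)))"
      unfolding Var_eq by (rule cong2_mod[OF subring_of_Ints])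
    then obtain u where "u \<in> \<int>" "?\<phi> (a0_poly L1 L2) = (- 1) ^ n * u + ?\<phi> (Var (Vt 0)) * ?\<phi> (Q_last L1 L2)"
      using hom_a0_poly[OF \<phi> subring_of_Ints _ nat_mod_two_less] by (auto simp: Var_eq)
    ultimately show "?\<phi> (a0_poly L1 L2) \<in> \<int>" by (simp add: Var_eq closed)
  qed
  show "fermat_pell integer_valued_polys (F_poly L1 L2)"
    using main[OF subring_of_integer_valued_polys Var a0 pos] .
qed

text \<open>Once c is replaced by 2 c + r, it is congruent to \<open>r\<close> inside
  \<open>integer_polys\<close> itself, and the parity argument applies to coefficients.\<close>

lemma fermat_pell_subst_c:
  assumes "r < 2"
  shows "fermat_pell integer_polys (subst_c r (F_poly L1 L2))"
proof (rule fermat_pell_hom[OF unital_ring_hom_subst_c subring_of_integer_polys _ _ unital_ring_hom_peval[OF unital_ring_hom_id]])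
  interpret subring_of integer_polys by (rule subring_of_integer_polys)
  note \<sigma> = unital_ring_hom_subst_c[of r]
  show Var: "subst_c r (Var v) \<in> integer_polys" for v
    by (cases v) (simp_all add: subst_c_Var closed Var_integer_poly)
  have a: "subst_c r (a_poly L1 L2 i) \<in> integer_polys" if "1 \<le> i" "i < Suc n" for i
    by (rule hom_a_poly_closed[OF \<sigma> subring_of_integer_polys]) (use that Var in simp_all)
  have Q: "subst_c r (Q_last L1 L2) \<in> integer_polys"
    unfolding hom_polys[OF \<sigma>] by (intro contQ_closed a) simp_all
  have "cong2 (subst_c r (Var Vc)) (int r)"
    by (rule cong2I[OF Var_integer_poly[of Vc]]) (simp add: subst_c_Var)
  from hom_a0_poly[OF \<sigma> subring_of_integer_polys this assms Var]
  show "subst_c r (a0_poly L1 L2) \<in> integer_polys"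
    using Q Var by (auto simp: closed)
  show "peval id (\<lambda>_. 0) (subst_c r (Var v)) \<ge> 0" for v
  proof -
    interpret unital_ring_hom "peval id (\<lambda>_. 0) :: qpoly \<Rightarrow> rat"
      by (rule unital_ring_hom_peval[OF unital_ring_hom_id])
    show ?thesis
      by (cases v) (simp_all add: subst_c_Var hom_simps peval_Var unital_ring_hom_id)
  qed
qed

section \<open>Integer values at a fixed non-negative point\<close>

context
  fixes c :: nat and t :: "nat \<Rightarrow> nat"
begin

abbreviation "quot \<equiv> a_form (int c) (\<lambda>j. int (t j)) L1 L2"
abbreviation "block \<equiv> map quot [1..<Suc n]"

lemma quot_pos: "quot i > 0"
  by (rule a_form_pos) simp_all

lemma value_at_a_poly:
  assumes "1 \<le> i" "i \<le> n"
  shows "value_at (a_poly L1 L2 i) t0 c t = of_int (quot i)"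
proof -
  have "value_at (a_poly L1 L2 i) t0 c t = a_form (of_nat c) (\<lambda>j. of_int (int (t j))) L1 L2 i"
    unfolding hom_a_poly[OF unital_ring_hom_value_at] value_at_Var
    by (rule a_form_cong) (use assms length1 in simp_all)
  also have "\<dots> = of_int (quot i)"
    unfolding unital_ring_hom.a_form[OF unital_ring_hom_of_int] by simp
  finally show ?thesis .
qed

lemma value_at_polys:
  "value_at (P_last L1 L2) t0 c t = of_int (contP quot (Suc n))"
  "value_at (P_prev L1 L2) t0 c t = of_int (contP quot n)"
  "value_at (Q_last L1 L2) t0 c t = of_int (contQ quot (Suc n))"
  unfolding hom_polys[OF unital_ring_hom_value_at]
    unital_ring_hom.contP[OF unital_ring_hom_of_int] unital_ring_hom.contQ[OF unital_ring_hom_of_int]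
  by (rule contP_cong contQ_cong; rule value_at_a_poly; simp)+

lemma map_value_at: "map (\<lambda>i. value_at (a_poly L1 L2 i) t0 c t) [1..<n + 1] = map of_int block"
  by (auto simp: value_at_a_poly)

lemma block_mod2: "map (\<lambda>b. b mod 2) block = map int (select c L1 L2)"
proof (rule nth_equalityI)
  fix i assume "i < length (map (\<lambda>b. b mod 2) block)"
  then have i: "i < n" by (simp del: upt_Suc)
  interpret subring_of "UNIV :: int set" by (rule subring_of_UNIV)
  have "cong2 (int c) (int (c mod 2))"
    using cong2_mod[OF subring_of_UNIV, where 'a = int, of "int c"] by (simp add: nat_mod_distrib)
  then have "cong2 (quot (Suc i)) (int (select (c mod 2) L1 L2 ! i))"
    using cong2_a_form[OF subring_of_UNIV, of "int c" "c mod 2" "\<lambda>j. int (t j)" "Suc i"] i by simp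
  then have "quot (Suc i) mod 2 = int (select c L1 L2 ! i) mod 2"
    by (auto simp: cong2_def select_def)
  moreover have "select c L1 L2 ! i < 2"
  proof -
    have "select c L1 L2 ! i \<in> set (select c L1 L2)" using i length_select by (metis nth_mem)
    then show ?thesis using permissible_select[of c] by (auto simp: permissible_def)
  qed
  ultimately show "map (\<lambda>b. b mod 2) block ! i = map int (select c L1 L2) ! i"
    using i length_select by (simp del: upt_Suc)
qed (simp add: length_select del: upt_Suc)

lemma cf_mat_block:
  "cf_mat block = (contQ quot (Suc n), contP quot (Suc n), contP quot (Suc n), contP quot n)"
  by (simp only: cf_mat_cont contQ_prev)

lemma admissible_iff:
  "admissible L1 L2 t0 c t \<longleftrightarrow>
    2 * t0 \<in> \<int> \<and> t0 * of_int (contQ quot (Suc n)) \<in> \<int> \<and>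
    t0 > (- 1) ^ (n + 1) * (of_int (contP quot (Suc n)) * of_int (contP quot n)) / (2 * of_int (contQ quot (Suc n)))"
  unfolding admissible_def value_at_polys length1
  by (simp only: polys_eq(1,4)[symmetric] polys_eq(4)[folded polys_eq(1)] value_at_polys)

text \<open>Any integer t_0 meets both integrality conditions, so it suffices to exceed the lower
  bound.\<close>

lemma ex_admissible: "\<exists>t0. admissible L1 L2 t0 c t"
  unfolding admissible_iff
proof (intro exI conjI)
  let ?v = "(- 1) ^ (n + 1) * (of_int (contP quot (Suc n)) * of_int (contP quot n)) / (2 * of_int (contQ quot (Suc n))) :: rat"
  let ?t0 = "of_int (\<lfloor>?v\<rfloor> + 1) :: rat"
  show "2 * ?t0 \<in> \<int>" "?t0 * of_int (contQ quot (Suc n)) \<in> \<int>"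
    by (intro Ints_mult Ints_of_int Ints_numeral)+
  show "?v < ?t0" by linarith
qed

lemma admissible_values:
  assumes "admissible L1 L2 t0 c t"
  obtains b0 D where "b0 > 0" "value_at (a0_poly L1 L2) t0 c t = of_int b0"
    "value_at (F_poly L1 L2) t0 c t = of_int D"
    "(D - b0\<^sup>2) * contQ quot (Suc n) = 2 * b0 * contP quot (Suc n) + contP quot n"
proof -
  define Q where "Q = contQ quot (Suc n)"
  define P where "P = contP quot (Suc n)"
  define R where "R = contP quot n"
  define s where "s = (- 1 :: int) ^ n"
  have s: "s * s = 1" by (simp add: s_def flip: power_mult_distrib)
  have Q: "Q > 0" unfolding Q_def by (rule contQ_pos) (rule quot_pos)
  have det: "Q * R - P * P = s"
    unfolding P_def Q_def R_def s_def by (rule det)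
  note value_eqs = value_at_polys[folded P_def Q_def R_def]
  interpret \<phi>: unital_ring_hom "\<lambda>p. value_at p t0 c t" by (rule unital_ring_hom_value_at)
  have "subring_of.cong2 (\<int> :: rat set) (value_at (Var Vc) t0 c t) (int (nat (int c mod 2)))"
    using cong2_mod[OF subring_of_Ints, of "int c"] by (simp add: value_at_Var)
  from hom_a0_poly[OF unital_ring_hom_value_at subring_of_Ints this nat_mod_two_less] obtain v
    where "v \<in> \<int>" and v: "of_int P * of_int R = 2 * v"
      "value_at (a0_poly L1 L2) t0 c t = (- 1) ^ n * v + t0 * of_int Q"
    by (auto simp: value_at_Var value_eqs)
  then obtain u where u: "v = of_int u" by (auto elim: Ints_cases)
  have PR: "P * R = 2 * u"
    using v(1) unfolding u by (metis (mono_tags) of_int_eq_iff of_int_mult of_int_numeral)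
  \<comment> \<open>Since t_0 may be half-integral, the integers 2 t_0 and t_0 Q_n are tracked
    separately and tied together by \<open>k * Q = 2 * m\<close>.\<close>
  obtain k where k: "2 * t0 = of_int k"
    using assms unfolding admissible_iff by (auto elim: Ints_cases)
  obtain m where m: "t0 * of_int Q = of_int m"
    using assms unfolding admissible_iff Q_def[symmetric] by (auto elim: Ints_cases)
  have "of_int (k * Q) = (of_int (2 * m) :: rat)"
    using m by (simp flip: k)
  then have kQ: "k * Q = 2 * m" by (simp only: of_int_eq_iff)
  define b0 where "b0 = s * u + m"
  define D where "D = b0\<^sup>2 + k * P + s * R\<^sup>2"
  have a0: "value_at (a0_poly L1 L2) t0 c t = of_int b0"
    unfolding v(2) u m by (simp add: b0_def s_def)
  have "value_at (F_poly L1 L2) t0 c t = (of_int b0)\<^sup>2 + 2 * t0 * of_int P + (- 1) ^ n * (of_int R)\<^sup>2"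
    unfolding F_poly_def by (simp add: \<phi>.hom_simps a0 value_eqs value_at_Var length1)
  also have "\<dots> = of_int D"
    unfolding k by (simp add: D_def s_def)
  finally have F: "value_at (F_poly L1 L2) t0 c t = of_int D" .
  \<comment> \<open>Multiplied by \<open>Q\<close>, the lower bound on t_0 is precisely the
    positivity of \<open>b0\<close>.\<close>
  have "t0 > (- 1) ^ (n + 1) * (of_int P * of_int R) / (2 * of_int Q)"
    using assms unfolding admissible_iff P_def Q_def R_def by simp
  moreover have "(- 1) ^ (n + 1) * (of_int P * of_int R) / (2 * of_int Q) = (- of_int (s * u) / of_int Q :: rat)"
    unfolding v(1) u by (simp add: s_def)
  ultimately have "- of_int (s * u) / of_int Q < t0" by simp
  moreover have "0 < (of_int Q :: rat)" using Q by simp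
  ultimately have "- of_int (s * u) < t0 * of_int Q" by (simp only: pos_divide_less_eq)
  then have "- of_int (s * u) < (of_int m :: rat)" by (simp only: m)
  then have "of_int (- (s * u)) < (of_int m :: rat)" by simp
  then have "- (s * u) < m" by (simp only: of_int_less_iff)
  then have b0: "b0 > 0" by (simp add: b0_def)
  \<comment> \<open>The determinant replaces \<open>Q * R\<close> by \<open>s + P * P\<close>; then
    \<open>s * s = 1\<close> isolates \<open>R\<close>, and \<open>P * R = 2 * u\<close> supplies
    the part of \<open>2 * b0 * P\<close> that comes from \<open>u\<close>.\<close>
  have "(D - b0\<^sup>2) * Q = k * Q * P + s * R * (Q * R)"
    by (simp add: D_def power2_eq_square algebra_simps)
  also have "\<dots> = 2 * m * P + s * R * (s + P * P)"
    using det kQ by (simp add: algebra_simps)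
  also have "\<dots> = 2 * m * P + (s * s) * R + s * P * (P * R)" by (simp add: algebra_simps)
  also have "\<dots> = 2 * b0 * P + R"
    unfolding PR s by (simp add: b0_def algebra_simps)
  finally have "(D - b0\<^sup>2) * contQ quot (Suc n) = 2 * b0 * contP quot (Suc n) + contP quot n"
    by (simp only: P_def Q_def R_def)
  with b0 a0 F show ?thesis by (rule that)
qed

lemma admissible_cf:
  assumes "b0 > 0" "(D - b0\<^sup>2) * contQ quot (Suc n) = 2 * b0 * contP quot (Suc n) + contP quot n"
  shows "D > 0" "has_periodic_cf (sqrt (of_int D)) b0 (block @ [2 * b0])"
proof -
  have pos: "b > 0" if "b \<in> set block" for b
    using that quot_pos by (auto simp del: upt_Suc)
  have ne: "block \<noteq> []" using n by simp
  have "b0\<^sup>2 < D" and per: "has_periodic_cf (sqrt (of_int D)) b0 (block @ [2 * b0])"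
    using has_periodic_cf_sqrt[OF pos ne cf_mat_block assms] by blast+
  show "D > 0" using \<open>b0\<^sup>2 < D\<close> by (rule le_less_trans[OF zero_le_power2])
  show "has_periodic_cf (sqrt (of_int D)) b0 (block @ [2 * b0])" by (rule per)
qed

text \<open>The length of \<open>L\<close> prescribes the length of the block in
  \<open>associated\<close>. Two blocks of equal length for the same square root coincide by
  uniqueness, so their residues can be compared.\<close>

lemma value_in_parity_class_iff:
  assumes "admissible L1 L2 t0 c t" "length L = n"
  shows "value_at (F_poly L1 L2) t0 c t \<in> of_int ` parity_class L \<longleftrightarrow> L = select c L1 L2"
proof -
  obtain b0 D where b0: "b0 > 0" and F: "value_at (F_poly L1 L2) t0 c t = of_int D"
    and eq: "(D - b0\<^sup>2) * contQ quot (Suc n) = 2 * b0 * contP quot (Suc n) + contP quot n"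
    using admissible_values[OF assms(1)] by blast
  note cf = admissible_cf[OF b0 eq]
  have len: "length block = n" by (simp del: upt_Suc)
  have "D \<in> parity_class L \<longleftrightarrow> L = select c L1 L2"
  proof
    assume "D \<in> parity_class L"
    then obtain c0 bs where bs: "has_periodic_cf (sqrt (of_int D)) c0 (bs @ [2 * c0])"
      "map (\<lambda>b. b mod 2) bs = map int L"
      by (auto simp: parity_class_def associated_def)
    have "length bs = n" using bs(2) assms(2) by (metis length_map)
    have "bs = block"
    proof (rule nth_equalityI)
      fix i assume "i < length bs"
      then show "bs ! i = block ! i"
        using has_periodic_cf_unique(2)[OF bs(1) cf(2), of i] \<open>length bs = n\<close> len
        by (simp add: nth_append del: upt_Suc)
    qed (simp only: \<open>length bs = n\<close> len)
    then have "map int L = map int (select c L1 L2)" using bs(2) block_mod2 by simp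
    then show "L = select c L1 L2" by (simp add: inj_map_eq_map inj_def)
  next
    assume "L = select c L1 L2"
    then have "map (\<lambda>b. b mod 2) block = map int L" by (simp only: block_mod2)
    with cf show "D \<in> parity_class L"
      unfolding parity_class_def associated_def by blast
  qed
  then show ?thesis unfolding F by auto
qed

lemma admissible_pell:
  assumes b0: "b0 > 0" and eq: "(D - b0\<^sup>2) * contQ quot (Suc n) = 2 * b0 * contP quot (Suc n) + contP quot n"
  defines "X \<equiv> b0 * contQ quot (Suc n) + contP quot (Suc n)" and "Y \<equiv> contQ quot (Suc n)"
  shows "positive_pell_solution D ((- 1) ^ (n - 1)) X Y"
    and "\<not> shorter_same_parity_period D b0 block \<Longrightarrow> fundamental_solution D ((- 1) ^ (n - 1)) X Y"
proof -
  note cf = admissible_cf[OF b0 eq]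
  have pos: "b > 0" if "b \<in> set block" for b
    using that quot_pos by (auto simp del: upt_Suc)
  have nonneg: "Y > 0" "contP quot (Suc n) \<ge> 0"
    unfolding Y_def using cf_mat_nonneg[OF cf_mat_block pos] by auto
  have e: "(- 1) ^ (n - 1) = (- 1 :: int) ^ Suc (length block)"
    using n by (cases n) (simp_all del: upt_Suc)
  \<comment> \<open>By the fixed-point equation the bracket equals P_{n-1}, which leaves minus the
    determinant of the block.\<close>
  have "X\<^sup>2 - D * Y\<^sup>2 = contP quot (Suc n) * contP quot (Suc n) - Y * ((D - b0\<^sup>2) * Y - 2 * b0 * contP quot (Suc n))"
    unfolding X_def Y_def[symmetric] by (simp add: power2_eq_square algebra_simps)
  also have "\<dots> = - (Y * contP quot n - contP quot (Suc n) * contP quot (Suc n))"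
    unfolding eq[folded Y_def] by simp
  also have "\<dots> = (- 1) ^ (n - 1)"
    unfolding Y_def det e by (simp del: upt_Suc)
  finally show pell: "positive_pell_solution D ((- 1) ^ (n - 1)) X Y"
    using b0 nonneg by (simp add: positive_pell_solution_def X_def Y_def[symmetric] add_pos_nonneg)
  show "fundamental_solution D ((- 1) ^ (n - 1)) X Y" if "\<not> shorter_same_parity_period D b0 block"
    unfolding e
  proof (rule fundamental_solution_if_no_shorter_period[OF cf(2) b0 pos _ _ that])
    show "Y = fst (cf_mat block)" by (simp only: cf_mat_block Y_def fst_conv)
    show "positive_pell_solution D ((- 1) ^ Suc (length block)) X Y" using pell by (simp only: e)
  qed
qed

lemma value_at_C_H:
  assumes "value_at (a0_poly L1 L2) t0 c t = of_int b0"
  shows "value_at (C_poly L1 L2) t0 c t = of_int (b0 * contQ quot (Suc n) + contP quot (Suc n))"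
    and "value_at (H_poly L1 L2) t0 c t = of_int (contQ quot (Suc n))"
proof -
  interpret \<phi>: unital_ring_hom "\<lambda>p. value_at p t0 c t" by (rule unital_ring_hom_value_at)
  show "value_at (C_poly L1 L2) t0 c t = of_int (b0 * contQ quot (Suc n) + contP quot (Suc n))"
    "value_at (H_poly L1 L2) t0 c t = of_int (contQ quot (Suc n))"
    unfolding C_poly_def H_poly_def
    by (simp_all only: \<phi>.hom_simps value_at_polys assms of_int_add of_int_mult)
qed

end

end

theorem theorem4:
  fixes n :: nat and L1 L2 :: "nat list"
  assumes "n \<ge> 1"
    and "length L1 = n" "permissible L1"
    and "length L2 = n" "permissible L2"
    and "L1 \<noteq> L2"
  shows
    "(fermat_pell integer_valued_polys (F_poly L1 L2) \<and>
      (\<forall>r\<in>{0, 1}. fermat_pell integer_polys (subst_c r (F_poly L1 L2))) \<and>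
      (a0_poly L1 L2 \<in> integer_polys \<longrightarrow> fermat_pell integer_polys (F_poly L1 L2)) \<and>
      (\<forall>t0 c t. admissible L1 L2 t0 c t \<longrightarrow>
         value_at (F_poly L1 L2) t0 c t \<in> of_int ` (parity_class L1 \<union> parity_class L2)) \<and>
      (\<exists>t0 c t. admissible L1 L2 t0 c t \<and> value_at (F_poly L1 L2) t0 c t \<in> of_int ` parity_class L1) \<and>
      (\<exists>t0 c t. admissible L1 L2 t0 c t \<and> value_at (F_poly L1 L2) t0 c t \<in> of_int ` parity_class L2) \<and>
      (\<forall>t0 c t t0' c' t'.
         admissible L1 L2 t0 c t \<and> admissible L1 L2 t0' c' t' \<and> (even c \<longleftrightarrow> even c') \<longrightarrow>
         (\<forall>L. length L = n \<and> permissible L \<longrightarrow>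
            (value_at (F_poly L1 L2) t0 c t \<in> of_int ` parity_class L \<longleftrightarrow>
             value_at (F_poly L1 L2) t0' c' t' \<in> of_int ` parity_class L))))
     \<and>
     (\<forall>t0 c t. admissible L1 L2 t0 c t \<longrightarrow>
       (\<exists>b0 bs. value_at (a0_poly L1 L2) t0 c t = of_int b0 \<and> b0 > 0 \<and>
          map (\<lambda>i. value_at (a_poly L1 L2 i) t0 c t) [1..<n + 1] = map of_int bs \<and>
          has_periodic_cf (sqrt (of_rat (value_at (F_poly L1 L2) t0 c t))) b0 (bs @ [2 * b0])))
     \<and>
     ((C_poly L1 L2)\<^sup>2 - F_poly L1 L2 * (H_poly L1 L2)\<^sup>2 = (-1) ^ (n - 1) \<and>
      (\<forall>t0 c t. admissible L1 L2 t0 c t \<longrightarrow>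
        (\<exists>D X Y b0 bs.
           value_at (F_poly L1 L2) t0 c t = of_int D \<and>
           value_at (C_poly L1 L2) t0 c t = of_int X \<and>
           value_at (H_poly L1 L2) t0 c t = of_int Y \<and>
           value_at (a0_poly L1 L2) t0 c t = of_int b0 \<and>
           map (\<lambda>i. value_at (a_poly L1 L2 i) t0 c t) [1..<n + 1] = map of_int bs \<and>
           positive_pell_solution D ((-1) ^ (n - 1)) X Y \<and>
           (\<not> shorter_same_parity_period D b0 bs \<longrightarrow>
              fundamental_solution D ((-1) ^ (n - 1)) X Y))))"
proof -
  interpret permissible_pair L1 L2 n
    by unfold_locales (fact assms)+
  have parity_iff: "value_at (F_poly L1 L2) t0 c t \<in> of_int ` parity_class L \<longleftrightarrow> L = select c L1 L2"
    if "admissible L1 L2 t0 c t" "length L = n" for t0 c t L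
    using value_in_parity_class_iff[OF that] .
  have pell: "\<exists>D X Y b0 bs.
      value_at (F_poly L1 L2) t0 c t = of_int D \<and>
      value_at (C_poly L1 L2) t0 c t = of_int X \<and>
      value_at (H_poly L1 L2) t0 c t = of_int Y \<and>
      value_at (a0_poly L1 L2) t0 c t = of_int b0 \<and>
      map (\<lambda>i. value_at (a_poly L1 L2 i) t0 c t) [1..<n + 1] = map of_int bs \<and>
      positive_pell_solution D ((-1) ^ (n - 1)) X Y \<and>
      (\<not> shorter_same_parity_period D b0 bs \<longrightarrow> fundamental_solution D ((-1) ^ (n - 1)) X Y)"
    and cf: "\<exists>b0 bs. value_at (a0_poly L1 L2) t0 c t = of_int b0 \<and> b0 > 0 \<and>
      map (\<lambda>i. value_at (a_poly L1 L2 i) t0 c t) [1..<n + 1] = map of_int bs \<and>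
      has_periodic_cf (sqrt (of_rat (value_at (F_poly L1 L2) t0 c t))) b0 (bs @ [2 * b0])"
    if "admissible L1 L2 t0 c t" for t0 c t
  proof -
    obtain b0 D where b0: "b0 > 0" and a0: "value_at (a0_poly L1 L2) t0 c t = of_int b0"
      and F: "value_at (F_poly L1 L2) t0 c t = of_int D"
      and eq: "(D - b0\<^sup>2) * contQ (quot c t) (Suc n) = 2 * b0 * contP (quot c t) (Suc n) + contP (quot c t) n"
      using admissible_values[OF \<open>admissible L1 L2 t0 c t\<close>] by blast
    show "\<exists>D X Y b0 bs.
      value_at (F_poly L1 L2) t0 c t = of_int D \<and>
      value_at (C_poly L1 L2) t0 c t = of_int X \<and>
      value_at (H_poly L1 L2) t0 c t = of_int Y \<and>
      value_at (a0_poly L1 L2) t0 c t = of_int b0 \<and>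
      map (\<lambda>i. value_at (a_poly L1 L2 i) t0 c t) [1..<n + 1] = map of_int bs \<and>
      positive_pell_solution D ((-1) ^ (n - 1)) X Y \<and>
      (\<not> shorter_same_parity_period D b0 bs \<longrightarrow> fundamental_solution D ((-1) ^ (n - 1)) X Y)"
      using F value_at_C_H[OF a0] a0 map_value_at admissible_pell[OF b0 eq] by blast
    have "has_periodic_cf (sqrt (of_rat (value_at (F_poly L1 L2) t0 c t))) b0 (block c t @ [2 * b0])"
      using admissible_cf(2)[OF b0 eq] by (simp only: F of_rat_of_int_eq)
    then show "\<exists>b0 bs. value_at (a0_poly L1 L2) t0 c t = of_int b0 \<and> b0 > 0 \<and>
      map (\<lambda>i. value_at (a_poly L1 L2 i) t0 c t) [1..<n + 1] = map of_int bs \<and>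
      has_periodic_cf (sqrt (of_rat (value_at (F_poly L1 L2) t0 c t))) b0 (bs @ [2 * b0])"
      using a0 b0 map_value_at by blast
  qed
  show ?thesis
  proof (intro conjI allI impI ballI)
    show "value_at (F_poly L1 L2) t0 c t \<in> of_int ` (parity_class L1 \<union> parity_class L2)"
      if "admissible L1 L2 t0 c t" for t0 c t
      using parity_iff[OF that length_select[of c]] unfolding image_Un by (auto simp: select_def split: if_splits)
    \<comment> \<open>The choice c = 0 selects \<open>L1\<close>, and c = 1 below selects
      \<open>L2\<close>.\<close>
    show "\<exists>t0 c t. admissible L1 L2 t0 c t \<and> value_at (F_poly L1 L2) t0 c t \<in> of_int ` parity_class L1"
      using ex_admissible[of 0 "\<lambda>_. 0"] parity_iff[OF _ assms(2)] by (metis even_zero select_def)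
    show "\<exists>t0 c t. admissible L1 L2 t0 c t \<and> value_at (F_poly L1 L2) t0 c t \<in> of_int ` parity_class L2"
      using ex_admissible[of 1 "\<lambda>_. 0"] parity_iff[OF _ assms(4)] by (metis odd_one select_def)
    show "value_at (F_poly L1 L2) t0 c t \<in> of_int ` parity_class L \<longleftrightarrow>
        value_at (F_poly L1 L2) t0' c' t' \<in> of_int ` parity_class L"
      if "admissible L1 L2 t0 c t \<and> admissible L1 L2 t0' c' t' \<and> even c = even c'" "length L = n \<and> permissible L"
      for t0 c t t0' c' t' L
      using that by (simp add: parity_iff select_def)
    show "fermat_pell integer_polys (subst_c r (F_poly L1 L2))" if "r \<in> {0, 1}" for r
      using that by (intro fermat_pell_subst_c) auto
  qed (fact fermat_pell_F_poly pell_identity_polys pell cf | (rule fermat_pell_F_poly pell cf; assumption))+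
qed

end
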